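(* Let $C_n(y,\lambda)$ be the polynomials defined by the J-type continued fraction in the context. For every $n\ge0$, $$C_n(y,\lambda)=\sum_{\sigma\in\mathfrak S_n}y^{\mathrm{pex}\,\sigma}\lambda^{\mathrm{ear}\,\sigma+\mathrm{fix}\,\sigma}=\sum_{\sigma\in\mathfrak S_n}y^{\mathrm{ear}\,\sigma}\lambda^{\mathrm{pex}\,\sigma+\mathrm{fix}\,\sigma}$$ $$=\sum_{\sigma\in\mathfrak S_n}y^{\mathrm{pcyc}\,\sigma}\lambda^{\mathrm{ear}\,\sigma+\mathrm{fix}\,\sigma}=\sum_{\sigma\in\mathfrak S_n}y^{\mathrm{ear}\,\sigma}\lambda^{\mathrm{cyc}\,\sigma}$$ $$=\sum_{\sigma\in\mathfrak S_n}y^{\mathrm{pcyc}\,\sigma}\lambda^{\mathrm{pex}\,\sigma+\mathrm{fix}\,\sigma}=\sum_{\sigma\in\mathfrak S_n}y^{\mathrm{pex}\,\sigma}\lambda^{\mathrm{cyc}\,\sigma}.$$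
   Context: The polynomials $A_n(t,\lambda,y,w)$ ($n\ge0$) are defined by $$\sum_{n\ge0}A_n(t,\lambda,y,w)z^n=\cfrac{1}{1-\gamma_0z-\cfrac{\beta_1z^2}{1-\gamma_1z-\cfrac{\beta_2z^2}{\cdots}}},\qquad \gamma_n=w+n(t+1)\ (n\ge0),\quad \beta_n=t(\lambda+n-1)(y+n-1)\ (n\ge1),$$ and $C_n(y,\lambda)=A_n(1,\lambda,y,\lambda)=A_n(1,y,\lambda,\lambda)$ (i.e. $\gamma_n=\lambda+2n$ and $\beta_n=(\lambda+n-1)(y+n-1)$). $\mathfrak S_n$ is the set of permutations of $[n]=\{1,\dots,n\}$ ($\mathfrak S_0$ consists of the empty permutation). For $\sigma\in\mathfrak S_n$: - $\mathrm{pex}\,\sigma$ is the number of $i$ with $\sigma(i)>i$ and $\sigma(j)\notin[i,\sigma(i)]$ for all $j<i$. - $\mathrm{cyc}\,\sigma$ is the number of cycles (fixed points included), $\mathrm{fix}\,\sigma$ the number of fixed points, $\mathrm{pcyc}\,\sigma=\mathrm{cyc}\,\sigma-\mathrm{fix}\,\sigma$. - An index $i$ is a record if $\sigma(j)<\sigma(i)$ for all $j<i$; an antirecord if $\sigma(j)>\sigma(i)$ for all $j>i$; an exclusive antirecord if it is an antirecord and not a record; a cycle peak if $\sigma^{-1}(i)<i>\sigma(i)$. $\mathrm{ear}\,\sigma$ is the number of $i$ that are both an exclusive antirecord and a cycle peak. *)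

theory Defs
  imports
    "HOL-Computational_Algebra.Formal_Power_Series"
    "HOL-Combinatorics.Orbits"
begin

unbundle fps_syntax

section \<open>J-type continued fractions\<close>

text \<open>
  Formal power series over an arbitrary commutative ring have no \<open>inverse\<close> in the library, because
  the coefficient ring has none. For a series \<open>f\<close> with constant coefficient 1,
  \<open>fps_right_inverse f 1\<close> is its multiplicative inverse.

  \<open>jfrac_convergent c b k\<close> is the continued fraction with coefficients \<open>c 0, c 1, \<dots>\<close> and
  \<open>b 1, b 2, \<dots>\<close> (\<open>b 0\<close> is not used), truncated to its first \<open>k\<close> denominators, the
  remaining tail being replaced by 0.
\<close>

fun jfrac_convergent ::
  "(nat \<Rightarrow> 'a::comm_ring_1) \<Rightarrow> (nat \<Rightarrow> 'a) \<Rightarrow> nat \<Rightarrow> 'a fps" where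
  "jfrac_convergent c b 0 = 0"
| "jfrac_convergent c b (Suc k) =
     fps_right_inverse
       (1 - fps_const (c 0) * fps_X
          - fps_const (b 1) * fps_X ^ 2 * jfrac_convergent (\<lambda>n. c (Suc n)) (\<lambda>n. b (Suc n)) k) 1"

declare jfrac_convergent.simps [simp del]

text \<open>The limit is taken in the usual (\<open>X\<close>-adic) topology of formal power series.\<close>

definition jfrac :: "(nat \<Rightarrow> 'a::comm_ring_1) \<Rightarrow> (nat \<Rightarrow> 'a) \<Rightarrow> 'a fps" where
  "jfrac c b = lim (jfrac_convergent c b)"

lemma jfrac_convergent_Suc:
  fixes c b :: "nat \<Rightarrow> 'a::comm_ring_1"
  shows "(1 - fps_const (c 0) * fps_X
          - fps_const (b 1) * fps_X ^ 2 * jfrac_convergent (\<lambda>n. c (Suc n)) (\<lambda>n. b (Suc n)) k)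
         * jfrac_convergent c b (Suc k) = 1"
  unfolding jfrac_convergent.simps by (rule fps_right_inverse) simp

lemma jfrac_convergent_cong_mod_X:
  fixes c b :: "nat \<Rightarrow> 'a::comm_ring_1"
  shows "fps_X ^ k dvd jfrac_convergent c b (Suc k) - jfrac_convergent c b k"
proof (induction k arbitrary: c b)
  case 0
  show ?case by simp
next
  case (Suc k)
  define t where "t = (\<lambda>k. jfrac_convergent (\<lambda>n. c (Suc n)) (\<lambda>n. b (Suc n)) k)"
  define f where "f = (\<lambda>k. 1 - fps_const (c 0) * fps_X - fps_const (b 1) * fps_X ^ 2 * t k)"
  define u where "u = (\<lambda>k. jfrac_convergent c b (Suc k))"
  have inv: "f j * u j = 1" for j
    unfolding f_def t_def u_def by (rule jfrac_convergent_Suc)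
  have "u (Suc k) - u k = u (Suc k) * (f k * u k) - u k * (f (Suc k) * u (Suc k))"
    by (simp add: inv)
  also have "\<dots> = u k * u (Suc k) * (f k - f (Suc k))"
    by (simp add: algebra_simps)
  also have "f k - f (Suc k) = fps_const (b 1) * fps_X * (fps_X * (t (Suc k) - t k))"
    by (simp add: f_def algebra_simps power2_eq_square)
  finally have eq: "u (Suc k) - u k =
      u k * u (Suc k) * (fps_const (b 1) * fps_X * (fps_X * (t (Suc k) - t k)))" .
  have "fps_X ^ k dvd t (Suc k) - t k"
    unfolding t_def by (rule Suc.IH)
  then have "fps_X ^ Suc k dvd fps_X * (t (Suc k) - t k)"
    by (simp add: mult_dvd_mono)
  then have "fps_X ^ Suc k dvd u (Suc k) - u k"
    unfolding eq by (rule dvd_mult[OF dvd_mult])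
  then show ?case unfolding u_def .
qed

lemma jfrac_convergent_nth_stable:
  fixes c b :: "nat \<Rightarrow> 'a::comm_ring_1"
  assumes "n < k"
  shows "jfrac_convergent c b k $ n = jfrac_convergent c b (Suc n) $ n"
proof -
  have step: "jfrac_convergent c b (Suc j) $ n = jfrac_convergent c b j $ n" if "n < j" for j
  proof -
    from jfrac_convergent_cong_mod_X[of j c b] obtain g where
      g: "jfrac_convergent c b (Suc j) - jfrac_convergent c b j = fps_X ^ j * g"
      by (rule dvdE)
    have "(jfrac_convergent c b (Suc j) - jfrac_convergent c b j) $ n = 0"
      using that unfolding g by (simp add: fps_X_power_mult_nth)
    then show ?thesis by simp
  qed
  from assms have "Suc n \<le> k" by simp
  then show ?thesis
    by (induction rule: dec_induct) (auto simp: step)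
qed

lemma jfrac_convergent_tendsto_Abs_fps:
  fixes c b :: "nat \<Rightarrow> 'a::comm_ring_1"
  shows "jfrac_convergent c b \<longlonglongrightarrow> Abs_fps (\<lambda>n. jfrac_convergent c b (Suc n) $ n)"
proof (rule tendsto_fpsI)
  fix n
  show "\<forall>\<^sub>F k in sequentially. jfrac_convergent c b k $ n =
          Abs_fps (\<lambda>n. jfrac_convergent c b (Suc n) $ n) $ n"
    using eventually_gt_at_top[of n]
    by eventually_elim (unfold fps_nth_Abs_fps, rule jfrac_convergent_nth_stable)
qed

lemma jfrac_eq_Abs_fps: "jfrac c b = Abs_fps (\<lambda>n. jfrac_convergent c b (Suc n) $ n)"
  unfolding jfrac_def by (rule limI) (rule jfrac_convergent_tendsto_Abs_fps)

lemma jfrac_convergent_tendsto: "jfrac_convergent c b \<longlonglongrightarrow> jfrac c b"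
  unfolding jfrac_eq_Abs_fps by (rule jfrac_convergent_tendsto_Abs_fps)

lemma jfrac_nth: "jfrac c b $ n = jfrac_convergent c b (Suc n) $ n"
  by (simp only: jfrac_eq_Abs_fps fps_nth_Abs_fps)

text \<open>
  The parameters range over an arbitrary commutative ring. The polynomial \<open>A\<^sub>n\<close> itself is the value
  at the indeterminates of a polynomial ring, so an identity for all commutative rings is the same as
  an identity of polynomials with integer coefficients.
\<close>

definition A_poly :: "nat \<Rightarrow> 'a::comm_ring_1 \<Rightarrow> 'a \<Rightarrow> 'a \<Rightarrow> 'a \<Rightarrow> 'a" where
  "A_poly n t lam y w =
     jfrac (\<lambda>k. w + of_nat k * (t + 1))
           (\<lambda>k. t * (lam + of_nat k - 1) * (y + of_nat k - 1)) $ n"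

definition C_poly :: "nat \<Rightarrow> 'a::comm_ring_1 \<Rightarrow> 'a \<Rightarrow> 'a" where
  "C_poly n y lam = A_poly n 1 lam y lam"

lemma C_poly_altdef: "C_poly n y lam = A_poly n 1 y lam lam"
  by (simp add: C_poly_def A_poly_def mult.commute)

section \<open>Permutation statistics\<close>

text \<open>
  The set \<open>\<SS>\<^sub>n\<close> is \<open>{\<sigma>. \<sigma> permutes {1..n}}\<close>: bijections of \<open>nat\<close> fixing every
  point outside \<open>{1..n}\<close>. All statistics therefore restrict indices to \<open>{1..n}\<close>.
\<close>

definition pex :: "nat \<Rightarrow> (nat \<Rightarrow> nat) \<Rightarrow> nat" where
  "pex n \<sigma> = card {i \<in> {1..n}. \<sigma> i > i \<and> (\<forall>j\<in>{1..n}. j < i \<longrightarrow> \<sigma> j \<notin> {i..\<sigma> i})}"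

definition cyc :: "nat \<Rightarrow> (nat \<Rightarrow> nat) \<Rightarrow> nat" where
  "cyc n \<sigma> = card (orbit \<sigma> ` {1..n})"

definition fixpts :: "nat \<Rightarrow> (nat \<Rightarrow> nat) \<Rightarrow> nat" where
  "fixpts n \<sigma> = card {i \<in> {1..n}. \<sigma> i = i}"

definition pcyc :: "nat \<Rightarrow> (nat \<Rightarrow> nat) \<Rightarrow> nat" where
  "pcyc n \<sigma> = cyc n \<sigma> - fixpts n \<sigma>"

text \<open>The subtraction of natural numbers in \<open>pcyc\<close> does not truncate:\<close>

lemma fixpts_le_cyc: "fixpts n \<sigma> \<le> cyc n \<sigma>"
proof -
  have orb: "orbit \<sigma> i = {i}" if "\<sigma> i = i" for i
    using that by (simp add: orbit_eq_singleton_iff)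
  have "inj_on (orbit \<sigma>) {i \<in> {1..n}. \<sigma> i = i}"
    by (auto simp: inj_on_def orb)
  then have "fixpts n \<sigma> = card (orbit \<sigma> ` {i \<in> {1..n}. \<sigma> i = i})"
    by (simp add: fixpts_def card_image)
  also have "\<dots> \<le> cyc n \<sigma>"
    unfolding cyc_def by (intro card_mono) auto
  finally show ?thesis .
qed

definition is_record :: "nat \<Rightarrow> (nat \<Rightarrow> nat) \<Rightarrow> nat \<Rightarrow> bool" where
  "is_record n \<sigma> i \<longleftrightarrow> (\<forall>j\<in>{1..n}. j < i \<longrightarrow> \<sigma> j < \<sigma> i)"

definition is_antirecord :: "nat \<Rightarrow> (nat \<Rightarrow> nat) \<Rightarrow> nat \<Rightarrow> bool" where
  "is_antirecord n \<sigma> i \<longleftrightarrow> (\<forall>j\<in>{1..n}. j > i \<longrightarrow> \<sigma> j > \<sigma> i)"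

definition is_exclusive_antirecord :: "nat \<Rightarrow> (nat \<Rightarrow> nat) \<Rightarrow> nat \<Rightarrow> bool" where
  "is_exclusive_antirecord n \<sigma> i \<longleftrightarrow> is_antirecord n \<sigma> i \<and> \<not> is_record n \<sigma> i"

definition is_cycle_peak :: "(nat \<Rightarrow> nat) \<Rightarrow> nat \<Rightarrow> bool" where
  "is_cycle_peak \<sigma> i \<longleftrightarrow> inv \<sigma> i < i \<and> i > \<sigma> i"

definition ear :: "nat \<Rightarrow> (nat \<Rightarrow> nat) \<Rightarrow> nat" where
  "ear n \<sigma> = card {i \<in> {1..n}. is_exclusive_antirecord n \<sigma> i \<and> is_cycle_peak \<sigma> i}"

end

theory Submission
  imports Defs
begin

text \<open>
  A permutation of \<open>[n]\<close> is scanned index by index: after \<open>k\<close> steps one knows the part of its graph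
  inside \<open>[k] \<times> [k]\<close>, in which some number \<open>h\<close> of positions and equally many values are still open.
  Adding the index \<open>k + 1\<close> changes \<open>h\<close> by at most one (a cycle valley opens a position and a value,
  a cycle peak closes one of each), so generating functions become weighted Motzkin paths, hence J-fractions.

  A cycle peak \<open>i\<close> counts for \<open>ear\<close> iff \<open>\<sigma> i\<close> is the smallest open value, and for \<open>pcyc\<close> iff it closes a
  cycle, which for each open value happens for exactly one open position and vice versa. Choosing
  value and position independently gives \<open>(x + h - 1) (y + h - 1)\<close> for the pair \<open>(ear, pcyc)\<close>.

  Whether an index counts for \<open>pex\<close> depends on the order in which the open positions will be closed. For
  the pairs \<open>(ear, pex)\<close> and \<open>(pcyc, pex)\<close> this order is therefore made part of the state. A new
  position may be inserted anywhere in it, a cycle valley counting for \<open>pex\<close> iff it is inserted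
  first (weight \<open>y + h\<close>), and closing a position leaves no choice except for the value (weight \<open>x + h - 1\<close>).
\<close>

section \<open>Weighted Motzkin paths and J-fractions\<close>

text \<open>The functional equation of the convergents passes to the limit: the coefficient of
  \<open>n\<close> on the left involves only coefficients up to \<open>n\<close> of the two series,
  and there they agree with sufficiently late convergents.\<close>

lemma jfrac_eq:
  fixes c b :: "nat \<Rightarrow> 'a::comm_ring_1"
  shows "(1 - fps_const (c 0) * fps_X
          - fps_const (b 1) * fps_X ^ 2 * jfrac (\<lambda>n. c (Suc n)) (\<lambda>n. b (Suc n)))
         * jfrac c b = 1"
proof (rule fps_ext)
  fix n
  define J where "J = jfrac (\<lambda>n. c (Suc n)) (\<lambda>n. b (Suc n))"
  define T where "T = jfrac_convergent (\<lambda>n. c (Suc n)) (\<lambda>n. b (Suc n)) (Suc n)"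
  define U where "U = jfrac_convergent c b (Suc (Suc n))"
  have J: "J $ i = T $ i" if "i \<le> n" for i
    unfolding J_def T_def jfrac_nth using that by (intro jfrac_convergent_nth_stable[symmetric]) simp
  have U: "jfrac c b $ i = U $ i" if "i \<le> n" for i
    unfolding U_def jfrac_nth using that by (intro jfrac_convergent_nth_stable[symmetric]) simp
  have "(fps_const (b 1) * fps_X ^ 2 * J) $ i = (fps_const (b 1) * fps_X ^ 2 * T) $ i"
    if "i \<le> n" for i
    using that J by (simp add: mult.assoc fps_X_power_mult_nth)
  then have "((1 - fps_const (c 0) * fps_X - fps_const (b 1) * fps_X ^ 2 * J) * jfrac c b) $ n =
    ((1 - fps_const (c 0) * fps_X - fps_const (b 1) * fps_X ^ 2 * T) * U) $ n"
    unfolding fps_mult_nth[of _ _ n] by (intro sum.cong refl) (simp add: U)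
  also have "\<dots> = 1 $ n"
    unfolding T_def U_def jfrac_convergent_Suc ..
  finally show "((1 - fps_const (c 0) * fps_X
          - fps_const (b 1) * fps_X ^ 2 * jfrac (\<lambda>n. c (Suc n)) (\<lambda>n. b (Suc n)))
         * jfrac c b) $ n = 1 $ n" unfolding J_def .
qed

text \<open>Total weight of the Motzkin paths with a given number of steps from height
  \<open>h\<close> down to 0. The weights \<open>u\<close>, \<open>c\<close>, \<open>d\<close> of
  up, level and down steps are indexed by the height at which the step starts.\<close>

fun path_sum :: "(nat \<Rightarrow> 'a::comm_ring_1) \<Rightarrow> (nat \<Rightarrow> 'a) \<Rightarrow> (nat \<Rightarrow> 'a) \<Rightarrow> nat \<Rightarrow> nat \<Rightarrow> 'a" where
  "path_sum u c d 0 h = (if h = 0 then 1 else 0)"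
| "path_sum u c d (Suc m) h = u h * path_sum u c d m (Suc h) + c h * path_sum u c d m h
     + (if h = 0 then 0 else d h * path_sum u c d m (h - 1))"

text \<open>In the proof, \<open>F h\<close> is the generating function of the paths from height \<open>h\<close> down to 0; by the first
  passage decomposition it is a product of tails of the continued fraction.\<close>

lemma path_sum_eq_jfrac:
  fixes u c d :: "nat \<Rightarrow> 'a::comm_ring_1"
  assumes b: "\<And>h. b (Suc h) = u h * d (Suc h)"
  shows "path_sum u c d m 0 = jfrac c b $ m"
proof -
  define J where "J h = jfrac (\<lambda>n. c (n + h)) (\<lambda>n. b (n + h))" for h
  define F where "F h = (\<Prod>i=1..h. fps_const (d i) * fps_X * J i) * J 0" for h
  have J: "J h = 1 + fps_X * (fps_const (c h) * J h + fps_const (u h * d (Suc h)) * fps_X * J (Suc h) * J h)"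
    for h
  proof -
    have "(1 - fps_const (c h) * fps_X - fps_const (b (Suc h)) * fps_X ^ 2 * J (Suc h)) * J h = 1"
      using jfrac_eq[of "\<lambda>n. c (n + h)" "\<lambda>n. b (n + h)"] by (simp add: J_def)
    then show ?thesis by (simp add: b algebra_simps power2_eq_square)
  qed
  have F_Suc: "F (Suc h) = fps_const (d (Suc h)) * fps_X * J (Suc h) * F h" for h
    by (simp add: F_def algebra_simps)
  have F0: "F 0 = 1 + fps_X * (fps_const (u 0) * F (Suc 0) + fps_const (c 0) * F 0)"
  proof -
    have "F 0 = J 0" by (simp add: F_def)
    then show ?thesis using J[of 0] by (simp add: F_Suc algebra_simps flip: fps_const_mult)
  qed
  have FS: "F (Suc h) = fps_X * (fps_const (u (Suc h)) * F (Suc (Suc h)) + fps_const (c (Suc h)) * F (Suc h)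
      + fps_const (d (Suc h)) * F h)" for h
  proof -
    have "F (Suc h) = fps_const (d (Suc h)) * fps_X * F h * J (Suc h)"
      by (simp add: F_Suc algebra_simps)
    also have "\<dots> = fps_const (d (Suc h)) * fps_X * F h * (1 + fps_X * (fps_const (c (Suc h)) * J (Suc h)
       + fps_const (u (Suc h) * d (Suc (Suc h))) * fps_X * J (Suc (Suc h)) * J (Suc h)))"
      by (subst J) (rule refl)
    also have "\<dots> = fps_X * (fps_const (u (Suc h)) * F (Suc (Suc h)) + fps_const (c (Suc h)) * F (Suc h)
      + fps_const (d (Suc h)) * F h)"
      by (simp add: F_Suc algebra_simps flip: fps_const_mult)
    finally show ?thesis .
  qed
  \<comment> \<open>By \<open>F0\<close> and \<open>FS\<close> the coefficients of
    \<open>F h\<close> obey the same recursion in \<open>m\<close> as \<open>path_sum\<close>, so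
    induction on the length identifies them.\<close>
  have "path_sum u c d m h = F h $ m" for h
  proof (induction m arbitrary: h)
    case 0
    show ?case
    proof (cases h)
      case 0 then show ?thesis using F0 by (metis fps_X_mult_nth fps_add_nth fps_one_nth add.right_neutral path_sum.simps(1))
    next
      case (Suc j) then show ?thesis by (subst Suc, subst FS) (simp add: Suc)
    qed
  next
    case (Suc m)
    show ?case
    proof (cases h)
      case 0 then show ?thesis by (subst 0, subst F0) (simp add: Suc.IH 0)
    next
      case (Suc j) then show ?thesis by (subst Suc, subst FS) (simp add: Suc.IH Suc)
    qed
  qed
  then show ?thesis by (simp add: F_def J_def)
qed

section \<open>Partial permutations and their extensions\<close>

text \<open>A relation needs no default values at open positions, and its converse simply exchanges
  positions and values.\<close>

definition trace :: "nat \<Rightarrow> (nat \<Rightarrow> nat) \<Rightarrow> (nat \<times> nat) set" where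
  "trace k \<sigma> = {(i, j). i \<in> {1..k} \<and> j \<in> {1..k} \<and> \<sigma> i = j}"

definition extensions :: "nat \<Rightarrow> nat \<Rightarrow> (nat \<times> nat) set \<Rightarrow> (nat \<Rightarrow> nat) set" where
  "extensions n k R = {\<sigma>. \<sigma> permutes {1..n} \<and> trace k \<sigma> = R}"

definition partial_perm :: "nat \<Rightarrow> (nat \<times> nat) set \<Rightarrow> bool" where
  "partial_perm k R \<longleftrightarrow> R \<subseteq> {1..k} \<times> {1..k} \<and> single_valued R \<and> single_valued (R\<inverse>)"

definition open_positions :: "nat \<Rightarrow> (nat \<times> nat) set \<Rightarrow> nat set" where
  "open_positions k R = {1..k} - Domain R"

definition open_values :: "nat \<Rightarrow> (nat \<times> nat) set \<Rightarrow> nat set" where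
  "open_values k R = {1..k} - Range R"

lemma finite_extensions [simp]: "finite (extensions n k R)"
proof -
  have "extensions n k R \<subseteq> {\<sigma>. \<sigma> permutes {1..n}}" by (auto simp: extensions_def)
  then show ?thesis by (rule finite_subset) (simp add: finite_permutations)
qed

lemma finite_open_positions [simp]: "finite (open_positions k R)"
  and finite_open_values [simp]: "finite (open_values k R)"
  by (simp_all add: open_positions_def open_values_def)

lemma partial_perm_converse: "partial_perm k (R\<inverse>) \<longleftrightarrow> partial_perm k R"
  by (auto simp: partial_perm_def)

lemma open_positions_converse: "open_positions k (R\<inverse>) = open_values k R"
  and open_values_converse: "open_values k (R\<inverse>) = open_positions k R"
  by (simp_all add: open_positions_def open_values_def)

text \<open>Both projections are injective on \<open>R\<close>, so its domain and range have equal
  size. The common number of open positions and open values is the height of the Motzkin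
  path.\<close>

lemma card_open:
  assumes "partial_perm k R"
  shows "card (open_positions k R) = card (open_values k R)"
proof -
  have R: "R \<subseteq> {1..k} \<times> {1..k}" "single_valued R" "single_valued (R\<inverse>)"
    using assms by (auto simp: partial_perm_def)
  have "inj_on fst R" "inj_on snd R"
    using R(2,3) by (force simp: inj_on_def single_valued_def)+
  then have "card (Domain R) = card (Range R)"
    by (simp add: Domain_fst Range_snd card_image)
  moreover have "Domain R \<subseteq> {1..k}" "Range R \<subseteq> {1..k}" using R(1) by auto
  ultimately show ?thesis
    by (simp add: open_positions_def open_values_def card_Diff_subset finite_subset)
qed

section \<open>What a partial permutation forces on its extensions\<close>

lemma extensionsD:
  assumes "\<sigma> \<in> extensions n k R"
  shows "\<sigma> permutes {1..n}"
    and "\<And>i j. (i, j) \<in> R \<longleftrightarrow> i \<in> {1..k} \<and> j \<in> {1..k} \<and> \<sigma> i = j"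
  using assms by (auto simp: extensions_def trace_def)

lemma permutes_ge_1:
  assumes "\<sigma> permutes {1..n::nat}" "1 \<le> i"
  shows "1 \<le> \<sigma> i"
  using permutes_in_image[OF assms(1), of i] permutes_not_in[OF assms(1), of i] assms(2)
  by (cases "i \<in> {1..n}") auto

text \<open>A value of at most \<open>k\<close> at \<open>p\<close> would put a pair with first
  entry \<open>p\<close> into the trace, and \<open>p\<close> would not be open.\<close>

lemma extension_open_position:
  assumes "\<sigma> \<in> extensions n k R" "p \<in> open_positions k R"
  shows "\<sigma> p > k"
proof (rule ccontr)
  assume "\<not> \<sigma> p > k"
  moreover have "1 \<le> \<sigma> p"
    using assms permutes_ge_1 extensionsD(1) unfolding open_positions_def by force
  ultimately have "(p, \<sigma> p) \<in> R"
    using assms extensionsD(2)[OF assms(1), of p "\<sigma> p"] by (auto simp: open_positions_def)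
  then show False using assms(2) by (auto simp: open_positions_def)
qed

lemma extension_open_value:
  assumes "\<sigma> \<in> extensions n k R" "v \<in> open_values k R"
  shows "inv \<sigma> v > k"
proof (rule ccontr)
  assume *: "\<not> inv \<sigma> v > k"
  have perm: "\<sigma> permutes {1..n}" by (rule extensionsD(1)[OF assms(1)])
  have "1 \<le> inv \<sigma> v"
    using assms(2) permutes_ge_1[OF permutes_inv[OF perm]] unfolding open_values_def by force
  moreover have "\<sigma> (inv \<sigma> v) = v" using perm by (rule permutes_inverses)
  ultimately have "(inv \<sigma> v, v) \<in> R"
    using * assms extensionsD(2)[OF assms(1), of "inv \<sigma> v" v] by (auto simp: open_values_def)
  then show False using assms(2) by (auto simp: open_values_def)
qed

lemma open_position_le: "p \<in> open_positions k R \<Longrightarrow> 1 \<le> p \<and> p \<le> k"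
  and open_value_le: "v \<in> open_values k R \<Longrightarrow> 1 \<le> v \<and> v \<le> k"
  by (auto simp: open_positions_def open_values_def)

text \<open>An open position would need a value beyond \<open>n\<close>; without open positions
  \<open>R\<close> is already the graph of one permutation. This matches the value of
  \<open>path_sum\<close> for length 0.\<close>

lemma extensions_self:
  assumes "partial_perm n R"
  shows "card (extensions n n R) = (if open_positions n R = {} then 1 else 0)"
proof (cases "open_positions n R = {}")
  case False
  then obtain p where p: "p \<in> open_positions n R" by auto
  have "\<sigma> \<notin> extensions n n R" for \<sigma>
  proof
    assume s: "\<sigma> \<in> extensions n n R"
    have "\<sigma> p > n" using extension_open_position[OF s p] .
    moreover have "\<sigma> p \<in> {1..n}"
      using open_position_le[OF p] permutes_in_image[OF extensionsD(1)[OF s]] by force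
    ultimately show False by simp
  qed
  then have "extensions n n R = {}" by blast
  then show ?thesis using False by simp
next
  case True
  have R: "R \<subseteq> {1..n} \<times> {1..n}" "single_valued R" "single_valued (R\<inverse>)"
    using assms by (auto simp: partial_perm_def)
  have ex: "\<exists>j. (i, j) \<in> R" if "i \<in> {1..n}" for i
    using True that by (auto simp: open_positions_def)
  \<comment> \<open>The function with graph \<open>R\<close>, continued by the identity outside
    \<open>{1..n}\<close> as \<open>permutes\<close> demands.\<close>
  define \<tau> where "\<tau> i = (if i \<in> {1..n} then THE j. (i, j) \<in> R else i)" for i
  have \<tau>: "(i, \<tau> i) \<in> R" if i: "i \<in> {1..n}" for i
  proof -
    obtain j where j: "(i, j) \<in> R" using ex[OF i] by blast
    then have "(THE j. (i, j) \<in> R) = j" using R(2) by (auto simp: single_valued_def)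
    then show ?thesis using i j by (simp add: \<tau>_def)
  qed
  have "inj_on \<tau> {1..n}"
    using \<tau> R(3) unfolding inj_on_def single_valued_def by (metis converse_iff)
  moreover have "\<tau> ` {1..n} \<subseteq> {1..n}" using \<tau> R(1) by blast
  ultimately have "bij_betw \<tau> {1..n} {1..n}"
    by (simp add: bij_betw_def endo_inj_surj)
  then have perm: "\<tau> permutes {1..n}"
    by (intro bij_imp_permutes) (auto simp: \<tau>_def)
  have "trace n \<tau> = R"
  proof (intro set_eqI iffI)
    fix q assume "q \<in> trace n \<tau>"
    then show "q \<in> R" using \<tau> by (auto simp: trace_def)
  next
    fix q assume q: "q \<in> R"
    obtain i j where ij: "q = (i, j)" by force
    have "i \<in> {1..n}" "j \<in> {1..n}" using q ij R(1) by auto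
    moreover have "\<tau> i = j" using \<tau>[of i] calculation q ij R(2) by (auto simp: single_valued_def)
    ultimately show "q \<in> trace n \<tau>" by (simp add: ij trace_def)
  qed
  then have "\<tau> \<in> extensions n n R" using perm by (simp add: extensions_def)
  moreover have "\<sigma> = \<tau>" if s: "\<sigma> \<in> extensions n n R" for \<sigma>
  proof
    fix i
    show "\<sigma> i = \<tau> i"
    proof (cases "i \<in> {1..n}")
      case True then show ?thesis using \<tau>[OF True] extensionsD(2)[OF s] by auto
    next
      case False then show ?thesis
        using permutes_not_in[OF extensionsD(1)[OF s] False] permutes_not_in[OF perm False] by simp
    qed
  qed
  ultimately have "extensions n n R = {\<tau>}" by blast
  then show ?thesis using True by simp
qed

section \<open>The five kinds of a new index\<close>

lemma trace_Suc:
  assumes "\<sigma> \<in> extensions n k R" and "k < n"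
  shows "trace (Suc k) \<sigma> \<in> {R, insert (Suc k, Suc k) R}
    \<union> (\<lambda>v. insert (Suc k, v) R) ` open_values k R
    \<union> (\<lambda>p. insert (p, Suc k) R) ` open_positions k R
    \<union> (\<lambda>(p, v). insert (p, Suc k) (insert (Suc k, v) R)) ` (open_positions k R \<times> open_values k R)"
proof -
  define m where "m = Suc k"
  have perm: "\<sigma> permutes {1..n}" by (rule extensionsD(1)[OF assms(1)])
  have R: "(i, j) \<in> R \<longleftrightarrow> i \<in> {1..k} \<and> j \<in> {1..k} \<and> \<sigma> i = j" for i j
    by (rule extensionsD(2)[OF assms(1)])
  have inj: "\<sigma> i = \<sigma> j \<Longrightarrow> i = j" for i j using permutes_inj[OF perm] by (auto dest: injD)
  have s_inv: "\<sigma> (inv \<sigma> j) = j" for j using perm by (rule permutes_inverses)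
  have pos: "1 \<le> \<sigma> m" "1 \<le> inv \<sigma> m"
    using permutes_ge_1[OF perm, of m] permutes_ge_1[OF permutes_inv[OF perm], of m]
    by (simp_all add: m_def)
  have tr: "(i, j) \<in> trace m \<sigma> \<longleftrightarrow> (i, j) \<in> R \<or> (i = m \<and> j = m \<and> \<sigma> m = m)
    \<or> (i = m \<and> j < m \<and> \<sigma> m = j) \<or> (j = m \<and> i < m \<and> inv \<sigma> m = i)" for i j
  proof (cases "i = m")
    case True
    then have "(i, j) \<notin> R" by (simp add: R m_def)
    moreover have "j = m \<and> \<sigma> m = j \<longleftrightarrow> j = m \<and> \<sigma> m = m" by blast
    ultimately show ?thesis using True pos by (auto simp: trace_def)
  next
    case False
    have "\<sigma> i = m \<longleftrightarrow> inv \<sigma> m = i" using s_inv[of m] inj by metis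
    then show ?thesis using False pos R[of i j] by (auto simp: trace_def m_def)
  qed
  have "\<sigma> i \<noteq> \<sigma> m" if "i \<le> k" for i
    using that inj[of i m] by (auto simp: m_def)
  then have ov: "\<sigma> m \<in> open_values k R" if "\<sigma> m < m"
    using that pos by (auto simp: open_values_def R m_def)
  have op: "inv \<sigma> m \<in> open_positions k R" if "inv \<sigma> m < m"
    using that pos s_inv[of m] by (auto simp: open_positions_def R m_def)
  \<comment> \<open>Fixed point, cycle valley, double fall, double rise, cycle peak. These are all
    cases, since \<open>\<sigma> m = m\<close> holds iff \<open>inv \<sigma> m = m\<close>.\<close>
  consider "\<sigma> m = m" | "\<sigma> m > m" "inv \<sigma> m > m" | "\<sigma> m < m" "inv \<sigma> m > m"
    | "\<sigma> m > m" "inv \<sigma> m < m" | "\<sigma> m < m" "inv \<sigma> m < m"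
    using s_inv[of m] by (metis linorder_neqE_nat)
  then have "trace m \<sigma> \<in> {R, insert (m, m) R}
    \<union> (\<lambda>v. insert (m, v) R) ` open_values k R
    \<union> (\<lambda>p. insert (p, m) R) ` open_positions k R
    \<union> (\<lambda>(p, v). insert (p, m) (insert (m, v) R)) ` (open_positions k R \<times> open_values k R)"
  proof cases
    case 1
    then have "inv \<sigma> m = m" using inj s_inv by metis
    with 1 have "trace m \<sigma> = insert (m, m) R" by (auto simp: tr)
    then show ?thesis by simp
  next
    case 2
    then have "trace m \<sigma> = R" by (auto simp: tr)
    then show ?thesis by simp
  next
    case 3
    then have "trace m \<sigma> = insert (m, \<sigma> m) R" by (auto simp: tr)
    then show ?thesis using ov 3 by blast
  next
    case 4
    then have "trace m \<sigma> = insert (inv \<sigma> m, m) R" by (auto simp: tr)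
    then show ?thesis using op 4 by blast
  next
    case 5
    then have "trace m \<sigma> = insert (inv \<sigma> m, m) (insert (m, \<sigma> m) R)" by (auto simp: tr)
    then show ?thesis using op ov 5 by blast
  qed
  then show ?thesis by (simp only: m_def)
qed

lemma trace_restrict: "trace k \<sigma> = trace (Suc k) \<sigma> \<inter> {1..k} \<times> {1..k}"
  by (auto simp: trace_def)

text \<open>The extensions are grouped by their trace on the first \<open>Suc k\<close> indices,
  which is one of the relations of \<open>trace_Suc\<close>. These relations are pairwise different,
  so each group contributes exactly one summand.\<close>

lemma sum_extensions_Suc:
  fixes f :: "(nat \<Rightarrow> nat) \<Rightarrow> 'a::comm_ring_1"
  assumes R: "partial_perm k R" and kn: "k < n"
  shows "sum f (extensions n k R) =
     sum f (extensions n (Suc k) R) + sum f (extensions n (Suc k) (insert (Suc k, Suc k) R))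
     + (\<Sum>v\<in>open_values k R. sum f (extensions n (Suc k) (insert (Suc k, v) R)))
     + (\<Sum>p\<in>open_positions k R. sum f (extensions n (Suc k) (insert (p, Suc k) R)))
     + (\<Sum>p\<in>open_positions k R. \<Sum>v\<in>open_values k R.
          sum f (extensions n (Suc k) (insert (p, Suc k) (insert (Suc k, v) R))))"
proof -
  define m where "m = Suc k"
  define V P where "V = open_values k R" and "P = open_positions k R"
  define T1 T2 T3 T4 where "T1 = {R, insert (m, m) R}"
    and "T2 = (\<lambda>v. insert (m, v) R) ` V" and "T3 = (\<lambda>p. insert (p, m) R) ` P"
    and "T4 = (\<lambda>(p, v). insert (p, m) (insert (m, v) R)) ` (P \<times> V)"
  define g where "g R' = sum f (extensions n m R')" for R'
  have RK: "R \<subseteq> {1..k} \<times> {1..k}" using R by (simp add: partial_perm_def)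
  have notin: "(m, j) \<notin> R" "(j, m) \<notin> R" for j using RK by (auto simp: m_def)
  have VP: "v \<in> V \<Longrightarrow> v \<noteq> m" "p \<in> P \<Longrightarrow> p \<noteq> m" for v p
    by (auto simp: V_def P_def open_values_def open_positions_def m_def)
  have fin: "finite V" "finite P" by (simp_all add: V_def P_def)
  have restr: "R' \<inter> {1..k} \<times> {1..k} = R" if "R' \<in> T1 \<union> T2 \<union> T3 \<union> T4" for R'
    using that RK by (auto simp: T1_def T2_def T3_def T4_def m_def)
  \<comment> \<open>Each candidate \<open>R'\<close> restricts to \<open>R\<close>, so trace
    \<open>R'\<close> at \<open>m\<close> already implies trace \<open>R\<close> at
    \<open>k\<close>.\<close>
  have fib: "{\<sigma> \<in> extensions n k R. trace m \<sigma> = R'} = extensions n m R'"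
    if "R' \<in> T1 \<union> T2 \<union> T3 \<union> T4" for R'
    using restr[OF that] trace_restrict[of k] by (auto simp: extensions_def m_def)
  have "sum f (extensions n k R) =
    (\<Sum>R'\<in>T1 \<union> T2 \<union> T3 \<union> T4. \<Sum>\<sigma>\<in>{\<sigma> \<in> extensions n k R. trace m \<sigma> = R'}. f \<sigma>)"
    using fin trace_Suc[OF _ kn, of _ R]
    by (intro sum.group[symmetric])
       (auto simp: T1_def T2_def T3_def T4_def m_def V_def P_def)
  also have "\<dots> = sum g (T1 \<union> T2 \<union> T3 \<union> T4)"
    by (intro sum.cong refl) (simp add: fib g_def)
  also have "\<dots> = sum g T1 + sum g T2 + sum g T3 + sum g T4"
  proof -
    \<comment> \<open>The four families are told apart by how \<open>m\<close> occurs: as a loop or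
      not at all, only as a position, only as a value, or as both without a loop.\<close>
    have c1: "((m, m) \<in> R' \<or> (\<forall>j. (m, j) \<notin> R' \<and> (j, m) \<notin> R'))" if "R' \<in> T1" for R'
      using that notin by (auto simp: T1_def)
    have c2: "(m, m) \<notin> R' \<and> (\<exists>j. (m, j) \<in> R') \<and> (\<forall>j. (j, m) \<notin> R')" if "R' \<in> T2" for R'
      using that notin VP by (auto simp: T2_def)
    have c3: "(m, m) \<notin> R' \<and> (\<exists>j. (j, m) \<in> R') \<and> (\<forall>j. (m, j) \<notin> R')" if "R' \<in> T3" for R'
      using that notin VP by (auto simp: T3_def)
    have c4: "(m, m) \<notin> R' \<and> (\<exists>j. (j, m) \<in> R') \<and> (\<exists>j. (m, j) \<in> R')" if "R' \<in> T4" for R'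
      using that notin VP by (auto simp: T4_def)
    have d1: "T1 \<inter> T2 = {}"
      using c1 c2 by blast
    have d2: "(T1 \<union> T2) \<inter> T3 = {}"
      using c1 c2 c3 by blast
    have d3: "(T1 \<union> T2 \<union> T3) \<inter> T4 = {}"
      using c1 c2 c3 c4 by blast
    have "finite T1" "finite T2" "finite T3" "finite T4"
      using fin by (simp_all add: T1_def T2_def T3_def T4_def)
    then show ?thesis using d1 d2 d3 by (simp add: sum.union_disjoint)
  qed
  also have "sum g T1 = g R + g (insert (m, m) R)"
    using notin[of m] by (subst T1_def, subst sum.insert) auto
  also have "sum g T2 = (\<Sum>v\<in>V. g (insert (m, v) R))"
  proof -
    have "inj_on (\<lambda>v. insert (m, v) R) V"
    proof (rule inj_onI)
      fix v v' assume "insert (m, v) R = insert (m, v') R"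
      then have "(m, v) \<in> insert (m, v') R" by auto
      then show "v = v'" using notin by simp
    qed
    then show ?thesis by (simp add: T2_def sum.reindex)
  qed
  also have "sum g T3 = (\<Sum>p\<in>P. g (insert (p, m) R))"
  proof -
    have "inj_on (\<lambda>p. insert (p, m) R) P"
    proof (rule inj_onI)
      fix p p' assume "insert (p, m) R = insert (p', m) R"
      then have "(p, m) \<in> insert (p', m) R" by auto
      then show "p = p'" using notin by simp
    qed
    then show ?thesis by (simp add: T3_def sum.reindex)
  qed
  also have "sum g T4 = (\<Sum>(p, v)\<in>P \<times> V. g (insert (p, m) (insert (m, v) R)))"
  proof -
    have "inj_on (\<lambda>(p, v). insert (p, m) (insert (m, v) R)) (P \<times> V)"
    proof (rule inj_onI, clarify)
      fix p v p' v' assume PV: "p \<in> P" "v \<in> V" "p' \<in> P" "v' \<in> V"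
        and "insert (p, m) (insert (m, v) R) = insert (p', m) (insert (m, v') R)"
      then have "(m, v) \<in> insert (p', m) (insert (m, v') R)" "(p, m) \<in> insert (p', m) (insert (m, v') R)"
        by auto
      then show "p = p' \<and> v = v'" using notin VP PV by auto
    qed
    then show ?thesis by (simp add: T4_def sum.reindex case_prod_beta' comp_def)
  qed
  finally show ?thesis
    by (simp add: sum.cartesian_product g_def m_def V_def P_def)
qed

section \<open>Effect of each kind of index on the open positions and values\<close>

lemma partial_perm_Suc:
  assumes "partial_perm k R"
  shows "partial_perm (Suc k) R" and "partial_perm (Suc k) (insert (Suc k, Suc k) R)"
    and "v \<in> open_values k R \<Longrightarrow> partial_perm (Suc k) (insert (Suc k, v) R)"
    and "p \<in> open_positions k R \<Longrightarrow> partial_perm (Suc k) (insert (p, Suc k) R)"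
    and "p \<in> open_positions k R \<Longrightarrow> v \<in> open_values k R \<Longrightarrow>
      partial_perm (Suc k) (insert (p, Suc k) (insert (Suc k, v) R))"
  using assms unfolding partial_perm_def open_positions_def open_values_def single_valued_def
  by auto

lemma open_positions_Suc:
  assumes "partial_perm k R"
  shows "open_positions (Suc k) R = insert (Suc k) (open_positions k R)"
    and "open_positions (Suc k) (insert (Suc k, v) R) = open_positions k R"
    and "p \<le> k \<Longrightarrow> open_positions (Suc k) (insert (p, Suc k) R) = insert (Suc k) (open_positions k R - {p})"
    and "p \<le> k \<Longrightarrow> open_positions (Suc k) (insert (p, Suc k) (insert (Suc k, v) R)) = open_positions k R - {p}"
  using assms unfolding partial_perm_def open_positions_def by auto

lemma open_values_Suc:
  assumes "partial_perm k R"
  shows "open_values (Suc k) R = insert (Suc k) (open_values k R)"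
    and "v \<le> k \<Longrightarrow> open_values (Suc k) (insert (Suc k, v) R) = insert (Suc k) (open_values k R - {v})"
    and "v \<le> k \<Longrightarrow> open_values (Suc k) (insert (p, Suc k) (insert (Suc k, v) R)) = open_values k R - {v}"
  using assms unfolding partial_perm_def open_values_def by auto

lemma Suc_not_open [simp]: "Suc k \<notin> open_positions k R" "Suc k \<notin> open_values k R"
  by (auto simp: open_positions_def open_values_def)

text \<open>An unchanged relation leaves \<open>Suc k\<close> itself open both as a position and as
  a value.\<close>

lemma extension_valley:
  assumes "partial_perm k R" "\<sigma> \<in> extensions n (Suc k) R"
  shows "\<sigma> (Suc k) > Suc k" "inv \<sigma> (Suc k) > Suc k"
  using assms extension_open_position[OF assms(2), of "Suc k"] extension_open_value[OF assms(2), of "Suc k"]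
  by (simp_all add: open_positions_Suc open_values_Suc)

lemma extension_fixpoint:
  assumes "\<sigma> \<in> extensions n (Suc k) (insert (Suc k, Suc k) R)"
  shows "\<sigma> (Suc k) = Suc k"
  using extensionsD(2)[OF assms, of "Suc k" "Suc k"] by auto

lemma extension_double_fall:
  assumes "partial_perm k R" "v \<in> open_values k R" "\<sigma> \<in> extensions n (Suc k) (insert (Suc k, v) R)"
  shows "\<sigma> (Suc k) = v" "inv \<sigma> (Suc k) > Suc k"
  using assms open_value_le[OF assms(2)] extensionsD(2)[OF assms(3), of "Suc k" v]
    extension_open_value[OF assms(3), of "Suc k"]
  by (auto simp: open_values_Suc)

lemma extension_double_rise:
  assumes "partial_perm k R" "p \<in> open_positions k R" "\<sigma> \<in> extensions n (Suc k) (insert (p, Suc k) R)"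
  shows "\<sigma> p = Suc k" "\<sigma> (Suc k) > Suc k"
  using assms open_position_le[OF assms(2)] extensionsD(2)[OF assms(3), of p "Suc k"]
    extension_open_position[OF assms(3), of "Suc k"]
  by (auto simp: open_positions_Suc)

lemma extension_peak:
  assumes "\<sigma> \<in> extensions n (Suc k) (insert (p, Suc k) (insert (Suc k, v) R))"
  shows "\<sigma> p = Suc k" "\<sigma> (Suc k) = v" "inv \<sigma> (Suc k) = p"
proof -
  show *: "\<sigma> p = Suc k" "\<sigma> (Suc k) = v"
    using extensionsD(2)[OF assms, of p "Suc k"] extensionsD(2)[OF assms, of "Suc k" v] by auto
  then show "inv \<sigma> (Suc k) = p"
    using extensionsD(1)[OF assms] permutes_inverses(2) by metis
qed

section \<open>Scanning a permutation\<close>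

text \<open>The factor that one index contributes to the monomial of a permutation. \<open>A\<close>
  is tested only at cycle peaks, whereas \<open>B\<close> is unrestricted because pseudo-excedances
  occur at cycle valleys.\<close>

definition weight ::
  "'a::comm_ring_1 \<Rightarrow> 'a \<Rightarrow> 'a \<Rightarrow> (nat \<Rightarrow> (nat \<Rightarrow> nat) \<Rightarrow> bool) \<Rightarrow> (nat \<Rightarrow> (nat \<Rightarrow> nat) \<Rightarrow> bool)
    \<Rightarrow> nat \<Rightarrow> (nat \<Rightarrow> nat) \<Rightarrow> 'a" where
  "weight w x y A B i \<sigma> =
     (if \<sigma> i = i then w else 1) * (if is_cycle_peak \<sigma> i \<and> A i \<sigma> then x else 1) * (if B i \<sigma> then y else 1)"

lemma prod_if_power:
  fixes x :: "'a::comm_monoid_mult"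
  assumes "finite S"
  shows "(\<Prod>i\<in>S. if P i then x else 1) = x ^ card {i \<in> S. P i}"
  using assms by (simp add: prod.inter_filter[symmetric])

lemma prod_weight:
  "(\<Prod>i\<in>{0<..n}. weight w x y A B i \<sigma>) =
     w ^ fixpts n \<sigma> * x ^ card {i \<in> {1..n}. is_cycle_peak \<sigma> i \<and> A i \<sigma>} * y ^ card {i \<in> {1..n}. B i \<sigma>}"
proof -
  have "{0<..n} = {1..n}" by auto
  then show ?thesis by (simp add: weight_def prod.distrib prod_if_power fixpts_def)
qed

section \<open>Statistics governed by independent choices at cycle peaks\<close>

lemma prod_Suc_greaterThan:
  fixes f :: "nat \<Rightarrow> 'a::comm_monoid_mult"
  assumes "k < n"
  shows "(\<Prod>i\<in>{k<..n}. f i) = f (Suc k) * (\<Prod>i\<in>{Suc k<..n}. f i)"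
proof -
  have "{k<..n} = insert (Suc k) {Suc k<..n}" using assms by auto
  then show ?thesis by simp
qed

text \<open>One distinguished choice among \<open>h\<close> has weight \<open>x\<close> and the
  others weight 1; this is the source of the factors \<open>x + h - 1\<close>.\<close>

lemma sum_marked:
  fixes x :: "'a::comm_ring_1"
  assumes "finite S" "a \<in> S"
  shows "(\<Sum>v\<in>S. if v = a then x else 1) = x + of_nat (card S) - 1"
proof -
  have "(\<Sum>v\<in>S. if v = a then x else 1) = (\<Sum>v\<in>S. (if v = a then x - 1 else 0) + 1)"
    by (intro sum.cong) auto
  also have "\<dots> = x + of_nat (card S) - 1"
    using assms by (simp add: sum.distrib algebra_simps)
  finally show ?thesis .
qed

text \<open>At a cycle peak, \<open>A\<close> singles out one open value and, for each value,
  \<open>B\<close> singles out one open position, giving the down weight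
  \<open>(x + h - 1) * (y + h - 1)\<close>. A valley has weight 1; a fixed point, \<open>h\<close>
  double falls and \<open>h\<close> double rises together give the level weight
  \<open>w + 2 * h\<close>. Hence only the number \<open>h\<close> of open positions matters, and
  downward induction on \<open>k\<close> reproduces the path recursion.\<close>

lemma sum_weight_unordered:
  fixes w x y :: "'a::comm_ring_1"
  assumes A: "\<And>k R p v \<sigma>. \<lbrakk>k < n; partial_perm k R; p \<in> open_positions k R; v \<in> open_values k R;
        \<sigma> \<in> extensions n (Suc k) (insert (p, Suc k) (insert (Suc k, v) R))\<rbrakk> \<Longrightarrow> A (Suc k) \<sigma> \<longleftrightarrow> v = a k R"
    and a: "\<And>k R. open_values k R \<noteq> {} \<Longrightarrow> partial_perm k R \<Longrightarrow> a k R \<in> open_values k R"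
    and B: "\<And>k R p v \<sigma>. \<lbrakk>k < n; partial_perm k R; p \<in> open_positions k R; v \<in> open_values k R;
        \<sigma> \<in> extensions n (Suc k) (insert (p, Suc k) (insert (Suc k, v) R))\<rbrakk> \<Longrightarrow> B (Suc k) \<sigma> \<longleftrightarrow> p = b k R v"
    and b: "\<And>k R v. partial_perm k R \<Longrightarrow> v \<in> open_values k R \<Longrightarrow> b k R v \<in> open_positions k R"
    and "k \<le> n" "partial_perm k R"
  defines "N \<equiv> path_sum (\<lambda>_. 1) (\<lambda>h. w + of_nat h * 2) (\<lambda>h. (x + of_nat h - 1) * (y + of_nat h - 1))"
  shows "(\<Sum>\<sigma>\<in>extensions n k R. \<Prod>i\<in>{k<..n}. weight w x y A (\<lambda>i \<sigma>. is_cycle_peak \<sigma> i \<and> B i \<sigma>) i \<sigma>)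
     = N (n - k) (card (open_positions k R))"
  using \<open>k \<le> n\<close> \<open>partial_perm k R\<close>
proof (induction arbitrary: R rule: inc_induct)
  case base
  then show ?case by (simp add: extensions_self N_def)
next
  case (step k)
  define m where "m = Suc k"
  define P V where "P = open_positions k R" and "V = open_values k R"
  define wt where "wt = weight w x y A (\<lambda>i \<sigma>. is_cycle_peak \<sigma> i \<and> B i \<sigma>)"
  define f where "f k \<sigma> = (\<Prod>i\<in>{k<..n}. wt i \<sigma>)" for k \<sigma>
  note R = step.prems
  have kn: "k < n" using step.hyps by simp
  have fin: "finite P" "finite V" by (simp_all add: P_def V_def)
  have cV: "card V = card P" using card_open[OF R] by (simp add: P_def V_def)
  \<comment> \<open>If index \<open>m\<close> has constant weight \<open>c\<close> on a class, this
    factor is taken out and the induction hypothesis evaluates the rest.\<close>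
  have part: "sum (f k) (extensions n m R') = c * N (n - m) h"
    if "partial_perm m R'" "card (open_positions m R') = h"
      "\<And>\<sigma>. \<sigma> \<in> extensions n m R' \<Longrightarrow> wt m \<sigma> = c" for R' c h
  proof -
    have "sum (f k) (extensions n m R') = (\<Sum>\<sigma>\<in>extensions n m R'. c * f m \<sigma>)"
      using that(3) kn by (intro sum.cong refl) (simp add: f_def prod_Suc_greaterThan m_def)
    also have "\<dots> = c * sum (f m) (extensions n m R')" by (simp add: sum_distrib_left)
    also have "sum (f m) (extensions n m R') = N (n - m) h"
      using step.IH[of R'] that(1,2) by (simp add: f_def m_def wt_def)
    finally show ?thesis .
  qed
  have valley: "sum (f k) (extensions n m R) = 1 * N (n - m) (Suc (card P))"
    using R fin
    by (intro part) (auto simp: m_def partial_perm_Suc(1,2) open_positions_Suc P_def wt_def weight_def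
        is_cycle_peak_def dest: extension_valley)
  have fix1: "sum (f k) (extensions n m (insert (m, m) R)) = w * N (n - m) (card P)"
    using R fin
    by (intro part) (auto simp: m_def partial_perm_Suc(1,2) open_positions_Suc P_def wt_def weight_def
        is_cycle_peak_def dest: extension_fixpoint)
  have fall: "sum (f k) (extensions n m (insert (m, v) R)) = 1 * N (n - m) (card P)"
    if v: "v \<in> V" for v
  proof (rule part)
    show "partial_perm m (insert (m, v) R)"
      using partial_perm_Suc(3)[OF R] v by (auto simp: m_def P_def V_def)
    show "card (open_positions m (insert (m, v) R)) = card P"
      using R by (simp add: m_def open_positions_Suc P_def)
    show "wt m \<sigma> = 1" if "\<sigma> \<in> extensions n m (insert (m, v) R)" for \<sigma>
      using extension_double_fall[OF R, of v \<sigma> n] open_value_le[of v k R] v that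
      by (auto simp: m_def V_def wt_def weight_def is_cycle_peak_def)
  qed
  have rise: "sum (f k) (extensions n m (insert (p, m) R)) = 1 * N (n - m) (card P)"
    if p: "p \<in> P" for p
  proof (rule part)
    show "partial_perm m (insert (p, m) R)"
      using partial_perm_Suc(4)[OF R] p by (auto simp: m_def P_def V_def)
    show "card (open_positions m (insert (p, m) R)) = card P"
      using R p fin open_position_le[of p k R] card_Suc_Diff1[of P p]
      by (simp add: m_def open_positions_Suc P_def)
    show "wt m \<sigma> = 1" if "\<sigma> \<in> extensions n m (insert (p, m) R)" for \<sigma>
      using extension_double_rise[OF R, of p \<sigma> n] p that
      by (auto simp: m_def P_def wt_def weight_def is_cycle_peak_def)
  qed
  have peak: "sum (f k) (extensions n m (insert (p, m) (insert (m, v) R))) =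
     (if v = a k R then x else 1) * (if p = b k R v then y else 1) * N (n - m) (card P - 1)"
    if p: "p \<in> P" and v: "v \<in> V" for p v
  proof (rule part)
    show "partial_perm m (insert (p, m) (insert (m, v) R))"
      using partial_perm_Suc(5)[OF R] p v by (auto simp: m_def P_def V_def)
    show "card (open_positions m (insert (p, m) (insert (m, v) R))) = card P - 1"
      using R p fin open_position_le[of p k R] by (simp add: m_def open_positions_Suc P_def)
    show "wt m \<sigma> = (if v = a k R then x else 1) * (if p = b k R v then y else 1)"
      if s: "\<sigma> \<in> extensions n m (insert (p, m) (insert (m, v) R))" for \<sigma>
    proof -
      have "\<sigma> m = v" "inv \<sigma> m = p" using extension_peak[of \<sigma> n k p v R] s by (simp_all add: m_def)
      moreover have "v < m" "p < m"
        using p v open_value_le[of v k R] open_position_le[of p k R] by (auto simp: m_def P_def V_def)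
      moreover have "A m \<sigma> \<longleftrightarrow> v = a k R" "B m \<sigma> \<longleftrightarrow> p = b k R v"
        using A[OF kn R _ _ s[unfolded m_def]] B[OF kn R _ _ s[unfolded m_def]] p v
        by (simp_all add: m_def P_def V_def)
      ultimately show ?thesis by (simp add: wt_def weight_def is_cycle_peak_def)
    qed
  qed
  have peaks: "(\<Sum>p\<in>P. \<Sum>v\<in>V. sum (f k) (extensions n m (insert (p, m) (insert (m, v) R)))) =
     (if card P = 0 then 0
      else (x + of_nat (card P) - 1) * (y + of_nat (card P) - 1) * N (n - m) (card P - 1))"
  proof (cases "P = {}")
    case False
    then have V: "V \<noteq> {}" using cV fin by auto
    \<comment> \<open>The marked position depends on \<open>v\<close>, so positions are summed
      first; the result \<open>y + h - 1\<close> is the same for every \<open>v\<close>.\<close>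
    have "(\<Sum>p\<in>P. \<Sum>v\<in>V. sum (f k) (extensions n m (insert (p, m) (insert (m, v) R)))) =
      (\<Sum>v\<in>V. \<Sum>p\<in>P. (if v = a k R then x else 1) * (if p = b k R v then y else 1) * N (n - m) (card P - 1))"
      by (subst sum.swap) (simp add: peak cong: sum.cong)
    also have "\<dots> = (\<Sum>v\<in>V. (if v = a k R then x else 1) * (y + of_nat (card P) - 1) * N (n - m) (card P - 1))"
      using b[OF R] fin
      by (intro sum.cong refl) (simp add: V_def P_def sum_marked flip: sum_distrib_left sum_distrib_right)
    also have "\<dots> = (x + of_nat (card P) - 1) * (y + of_nat (card P) - 1) * N (n - m) (card P - 1)"
      using a[OF _ R] V fin cV
      by (simp add: V_def P_def sum_marked flip: sum_distrib_left sum_distrib_right)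
    finally show ?thesis using False fin by simp
  qed simp
  have nk: "n - k = Suc (n - m)" using kn by (simp add: m_def)
  have "sum (f k) (extensions n k R) = N (n - k) (card P)"
    unfolding sum_extensions_Suc[OF R kn] m_def[symmetric] P_def[symmetric] V_def[symmetric] peaks nk
    using fin cV by (simp add: valley fix1 fall rise N_def algebra_simps)
  then show ?case by (simp add: f_def wt_def P_def)
qed

section \<open>Statistics that depend on the order in which positions are closed\<close>

lemma sum_sorted_insertions:
  fixes c :: "'b::comm_monoid_add" and y :: "'a::linorder"
  assumes "y \<notin> set xs"
  shows "(\<Sum>r\<le>length xs. if sorted_wrt (<) (take r xs @ y # drop r xs) then c else 0)
     = (if sorted_wrt (<) xs then c else 0)"
  using assms
proof (induction xs)
  case (Cons a xs)
  let ?s = "\<lambda>xs r. sorted_wrt (<) (take r xs @ y # drop r xs)"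
  \<comment> \<open>A sorted list has exactly one sorted insertion of a new element, any other list
    has none. In the induction either \<open>y\<close> comes before \<open>a\<close>, or
    \<open>a\<close> lies below \<open>y\<close> and below all of \<open>xs\<close> and
    \<open>y\<close> is inserted into \<open>xs\<close>.\<close>
  have "(\<Sum>r\<le>length (a # xs). if ?s (a # xs) r then c else 0)
    = (if ?s (a # xs) 0 then c else 0) + (\<Sum>r\<le>length xs. if ?s (a # xs) (Suc r) then c else 0)"
    by (simp only: length_Cons sum.atMost_Suc_shift)
  also have "(\<Sum>r\<le>length xs. if ?s (a # xs) (Suc r) then c else 0)
    = (\<Sum>r\<le>length xs. if ?s xs r then (if a < y \<and> (\<forall>z\<in>set xs. a < z) then c else 0) else 0)"
  proof (intro sum.cong refl)
    fix r
    have "set xs = set (take r xs) \<union> set (drop r xs)"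
      by (metis append_take_drop_id set_append)
    then show "(if ?s (a # xs) (Suc r) then c else 0) =
      (if ?s xs r then (if a < y \<and> (\<forall>z\<in>set xs. a < z) then c else 0) else 0)"
      by auto
  qed
  also have "\<dots> = (if a < y \<and> (\<forall>z\<in>set xs. a < z) then (\<Sum>r\<le>length xs. if ?s xs r then c else 0) else 0)"
  proof -
    have "(\<Sum>r\<le>length xs. if S r then (if Q then c else 0) else 0)
       = (if Q then (\<Sum>r\<le>length xs. if S r then c else 0) else 0)" for S Q
      by (cases Q) simp_all
    then show ?thesis .
  qed
  also have "\<dots> = (if a < y \<and> sorted_wrt (<) (a # xs) then c else 0)"
  proof -
    have "(\<Sum>r\<le>length xs. if ?s xs r then c else 0) = (if sorted_wrt (<) xs then c else 0)"
      using Cons by simp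
    then show ?thesis by auto
  qed
  finally show ?case using Cons.prems by (cases "a < y") auto
qed simp

lemma sum_indicator_first:
  fixes y :: "'a::comm_ring_1"
  shows "(\<Sum>r\<le>h. if r = 0 then y else 1) = y + of_nat h"
  by (induction h) (simp_all add: algebra_simps)

text \<open>An open position \<open>p\<close> is closed when the scan reaches
  \<open>\<sigma> p\<close>, so increasing values mean that \<open>ps\<close> lists the positions in
  order of closing.\<close>

definition values_sorted :: "nat list \<Rightarrow> (nat \<Rightarrow> nat) \<Rightarrow> bool" where
  "values_sorted ps \<sigma> \<longleftrightarrow> sorted_wrt (<) (map \<sigma> ps)"

definition pseudo_excedance :: "nat \<Rightarrow> nat \<Rightarrow> (nat \<Rightarrow> nat) \<Rightarrow> bool" where
  "pseudo_excedance n i \<sigma> \<longleftrightarrow> \<sigma> i > i \<and> (\<forall>j\<in>{1..n}. j < i \<longrightarrow> \<sigma> j \<notin> {i..\<sigma> i})"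

lemma sum_values_sorted_insertions:
  fixes c :: "'b::comm_monoid_add"
  assumes "inj \<sigma>" "m \<notin> set ps"
  shows "(if values_sorted ps \<sigma> then c else 0)
     = (\<Sum>r\<le>length ps. if values_sorted (take r ps @ m # drop r ps) \<sigma> then c else 0)"
  using sum_sorted_insertions[of "\<sigma> m" "map \<sigma> ps" c] assms
  by (simp add: values_sorted_def take_map drop_map inj_image_mem_iff)

text \<open>Earlier positions that are not open have values of at most \<open>k\<close> and do no
  harm; the open ones have values above \<open>Suc k\<close>. So only those that are closed before
  \<open>Suc k\<close> obstruct, and there are none iff \<open>Suc k\<close> comes first in the
  order.\<close>

lemma pseudo_excedance_valley:
  assumes R: "partial_perm k R" and kn: "k < n" and s: "\<sigma> \<in> extensions n (Suc k) R"
    and ps: "set ps = open_positions k R" and r: "r \<le> length ps"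
    and v: "values_sorted (take r ps @ Suc k # drop r ps) \<sigma>"
  shows "pseudo_excedance n (Suc k) \<sigma> \<longleftrightarrow> r = 0"
proof
  have gt: "\<sigma> p > Suc k" if "p \<in> set ps" for p
    using extension_open_position[OF s, of p] that R by (simp add: ps open_positions_Suc)
  {
    assume "pseudo_excedance n (Suc k) \<sigma>"
    then have *: "\<And>j. j \<in> {1..n} \<Longrightarrow> j < Suc k \<Longrightarrow> \<sigma> j \<notin> {Suc k..\<sigma> (Suc k)}"
      by (auto simp: pseudo_excedance_def)
    show "r = 0"
    proof (rule ccontr)
      assume "r \<noteq> 0"
      then obtain p where p: "p \<in> set (take r ps)" using r
        by (metis length_greater_0_conv length_take list.set_intros(1) min.absorb2 neq_Nil_conv neq0_conv)
      then have "\<sigma> p < \<sigma> (Suc k)" using v by (auto simp: values_sorted_def sorted_wrt_append)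
      moreover have "p \<in> set ps" using p by (rule in_set_takeD)
      ultimately show False using *[of p] gt[of p] open_position_le[of p k R] kn ps by auto
    qed
  next
    assume "r = 0"
    then have less: "\<sigma> (Suc k) < \<sigma> p" if "p \<in> open_positions k R" for p
      using v that ps by (auto simp: values_sorted_def)
    have "\<sigma> j \<notin> {Suc k..\<sigma> (Suc k)}" if j: "1 \<le> j" "j < Suc k" for j
    proof (cases "j \<in> open_positions k R")
      case True then show ?thesis using less[OF True] by auto
    next
      case False
      then obtain i where "(j, i) \<in> R" using j by (auto simp: open_positions_def)
      then have "\<sigma> j \<le> k" using R extensionsD(2)[OF s, of j i] by (auto simp: partial_perm_def)
      then show ?thesis by simp
    qed
    then show "pseudo_excedance n (Suc k) \<sigma>"
      using extension_valley[OF R s] by (auto simp: pseudo_excedance_def)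
  }
qed

text \<open>The prescribed order \<open>ps\<close> is part of the state. A valley may be inserted at
  \<open>h + 1\<close> places, the first of which has weight \<open>y\<close>: up weight
  \<open>y + h\<close>. Only the head of \<open>ps\<close> can be closed next. At a peak this leaves
  just the value to choose, giving \<open>x + h - 1\<close>, so the marked value may depend on the
  position; at a double rise there are \<open>h\<close> places for reinsertion. The level weight is
  again \<open>w + 2 * h\<close>.\<close>

lemma sum_weight_ordered:
  fixes w x y :: "'a::comm_ring_1"
  assumes A: "\<And>k R p v \<sigma>. \<lbrakk>k < n; partial_perm k R; p \<in> open_positions k R; v \<in> open_values k R;
        \<sigma> \<in> extensions n (Suc k) (insert (p, Suc k) (insert (Suc k, v) R))\<rbrakk> \<Longrightarrow> A (Suc k) \<sigma> \<longleftrightarrow> v = a k R p"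
    and a: "\<And>k R p. partial_perm k R \<Longrightarrow> p \<in> open_positions k R \<Longrightarrow> a k R p \<in> open_values k R"
    and "k \<le> n" "partial_perm k R" "distinct ps" "set ps = open_positions k R"
  defines "N \<equiv> path_sum (\<lambda>h. y + of_nat h) (\<lambda>h. w + of_nat h * 2) (\<lambda>h. x + of_nat h - 1)"
  shows "(\<Sum>\<sigma>\<in>extensions n k R. if values_sorted ps \<sigma>
            then \<Prod>i\<in>{k<..n}. weight w x y A (pseudo_excedance n) i \<sigma> else 0)
     = N (n - k) (length ps)"
  using \<open>k \<le> n\<close> \<open>partial_perm k R\<close> \<open>distinct ps\<close> \<open>set ps = open_positions k R\<close>
proof (induction arbitrary: R ps rule: inc_induct)
  case base
  show ?case
  proof (cases "ps = []")
    case True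
    then show ?thesis using base by (simp add: extensions_self N_def values_sorted_def)
  next
    case False
    then have "extensions n n R = {}"
      using base extensions_self[of n R] by (metis card_0_eq finite_extensions set_empty)
    then show ?thesis using False by (simp add: N_def)
  qed
next
  case (step k)
  define m where "m = Suc k"
  define P V where "P = open_positions k R" and "V = open_values k R"
  define wt where "wt = weight w x y A (pseudo_excedance n)"
  define f where "f k ps \<sigma> = (if values_sorted ps \<sigma> then \<Prod>i\<in>{k<..n}. wt i \<sigma> else 0)" for k ps \<sigma>
  note R = step.prems(1)
  have ps: "distinct ps" "set ps = P" using step.prems by (simp_all add: P_def)
  have kn: "k < n" using step.hyps by simp
  have fin: "finite P" "finite V" by (simp_all add: P_def V_def)
  have cP: "card P = length ps" using ps distinct_card by fastforce
  then have cV: "card V = length ps" using card_open[OF R] by (simp add: P_def V_def)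
  have mP: "m \<notin> set ps" by (simp add: ps P_def m_def)
  have gt: "\<sigma> p > m" if "p \<in> open_positions m R'" "\<sigma> \<in> extensions n m R'" for p \<sigma> R'
    using extension_open_position that by blast
  have part: "sum (f k qs) (extensions n m R') = c * N (n - m) (length qs)"
    if "partial_perm m R'" "set qs = open_positions m R'" "distinct qs"
      "\<And>\<sigma>. \<sigma> \<in> extensions n m R' \<Longrightarrow> values_sorted qs \<sigma> \<Longrightarrow> wt m \<sigma> = c" for R' c qs
  proof -
    have "sum (f k qs) (extensions n m R') = (\<Sum>\<sigma>\<in>extensions n m R'. c * f m qs \<sigma>)"
      using that(4) kn by (intro sum.cong refl) (simp add: f_def prod_Suc_greaterThan m_def)
    also have "\<dots> = c * sum (f m qs) (extensions n m R')" by (simp add: sum_distrib_left)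
    also have "sum (f m qs) (extensions n m R') = N (n - m) (length qs)"
      using step.IH[of R' qs] that(1,2,3) by (simp add: f_def m_def wt_def cong: if_cong)
    finally show ?thesis .
  qed
  \<comment> \<open>Used when \<open>m\<close> becomes an open position: an extension that respects
    \<open>qs\<close> respects exactly one list obtained by inserting \<open>m\<close> into
    \<open>qs\<close>, and \<open>c r\<close> is the weight of index \<open>m\<close> for place
    \<open>r\<close>.\<close>
  have insertion: "sum (f k qs) (extensions n m R') =
      (\<Sum>r\<le>length qs. c r) * N (n - m) (Suc (length qs))"
    if "partial_perm m R'" "set qs = open_positions m R' - {m}" "m \<in> open_positions m R'" "distinct qs"
      "\<And>\<sigma> r. \<sigma> \<in> extensions n m R' \<Longrightarrow> r \<le> length qs \<Longrightarrow>
         values_sorted (take r qs @ m # drop r qs) \<sigma> \<Longrightarrow> wt m \<sigma> = c r" for R' c qs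
  proof -
    have "sum (f k qs) (extensions n m R') =
      (\<Sum>\<sigma>\<in>extensions n m R'. \<Sum>r\<le>length qs. f k (take r qs @ m # drop r qs) \<sigma>)"
    proof (intro sum.cong refl)
      fix \<sigma> assume "\<sigma> \<in> extensions n m R'"
      then have "inj \<sigma>" using extensionsD(1) permutes_inj by blast
      then show "f k qs \<sigma> = (\<Sum>r\<le>length qs. f k (take r qs @ m # drop r qs) \<sigma>)"
        unfolding f_def using that(2) by (intro sum_values_sorted_insertions) auto
    qed
    also have "\<dots> = (\<Sum>r\<le>length qs. sum (f k (take r qs @ m # drop r qs)) (extensions n m R'))"
      by (rule sum.swap)
    also have "\<dots> = (\<Sum>r\<le>length qs. c r * N (n - m) (Suc (length qs)))"
    proof (intro sum.cong refl)
      fix r assume r: "r \<in> {..length qs}"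
      have "set qs = set (take r qs) \<union> set (drop r qs)"
        by (metis append_take_drop_id set_append)
      moreover have "distinct (take r qs @ drop r qs)" using that(4) by simp
      ultimately have "set (take r qs @ m # drop r qs) = open_positions m R'"
        "distinct (take r qs @ m # drop r qs)"
        using that(2,3) by (auto simp del: append_take_drop_id)
      then have "sum (f k (take r qs @ m # drop r qs)) (extensions n m R') =
          c r * N (n - m) (length (take r qs @ m # drop r qs))"
        using that(1,5) r by (intro part) auto
      then show "sum (f k (take r qs @ m # drop r qs)) (extensions n m R') =
          c r * N (n - m) (Suc (length qs))" using r by simp
    qed
    finally show ?thesis by (simp add: sum_distrib_right)
  qed
  have valley: "sum (f k ps) (extensions n m R) = (y + of_nat (length ps)) * N (n - m) (Suc (length ps))"
    unfolding sum_indicator_first[symmetric]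
  proof (rule insertion)
    show "wt m \<sigma> = (if r = 0 then y else 1)"
      if "\<sigma> \<in> extensions n m R" "r \<le> length ps" "values_sorted (take r ps @ m # drop r ps) \<sigma>" for \<sigma> r
      using pseudo_excedance_valley[OF R kn, of \<sigma> ps r] extension_valley[OF R, of \<sigma> n] that ps
      by (auto simp: wt_def weight_def is_cycle_peak_def m_def P_def)
  qed (use R ps in \<open>auto simp: m_def partial_perm_Suc(1,2) open_positions_Suc P_def\<close>)
  have fix1: "sum (f k ps) (extensions n m (insert (m, m) R)) = w * N (n - m) (length ps)"
    using R ps
    by (intro part) (auto simp: m_def partial_perm_Suc(1,2) open_positions_Suc P_def wt_def weight_def
        is_cycle_peak_def pseudo_excedance_def dest: extension_fixpoint)
  have fall: "sum (f k ps) (extensions n m (insert (m, v) R)) = 1 * N (n - m) (length ps)"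
    if v: "v \<in> V" for v
  proof (rule part)
    show "partial_perm m (insert (m, v) R)"
      using partial_perm_Suc(3)[OF R] v by (auto simp: m_def P_def V_def)
    show "set ps = open_positions m (insert (m, v) R)"
      using R ps by (simp add: m_def open_positions_Suc P_def)
    show "wt m \<sigma> = 1" if "\<sigma> \<in> extensions n m (insert (m, v) R)" for \<sigma>
      using extension_double_fall[OF R, of v \<sigma> n] open_value_le[of v k R] v that
      by (auto simp: m_def V_def wt_def weight_def is_cycle_peak_def pseudo_excedance_def)
  qed (fact ps)
  have closing: "(\<Sum>p\<in>P. sum (f k ps) (extensions n m (insert (p, m) R))) =
      of_nat (length ps) * N (n - m) (length ps) \<and>
    (\<Sum>p\<in>P. \<Sum>v\<in>V. sum (f k ps) (extensions n m (insert (p, m) (insert (m, v) R)))) =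
      (if length ps = 0 then 0 else (x + of_nat (length ps) - 1) * N (n - m) (length ps - 1))"
  proof (cases ps)
    case Nil
    then show ?thesis using ps by simp
  next
    case (Cons p0 qs)
    have p0: "p0 \<in> P" "p0 < m" and qs: "set qs = P - {p0}" "distinct qs" "m \<notin> set qs"
      using ps mP Cons open_position_le[of p0 k R] by (auto simp: P_def[symmetric] m_def)
    \<comment> \<open>The position closed at \<open>m\<close> has a smaller value than every
      position still open, so it must be the head of \<open>ps\<close>; otherwise the summand is
      0.\<close>
    have cl: "f k ps \<sigma> = (if p = p0 then f k qs \<sigma> else 0)"
      if p: "p \<in> P" and s: "\<sigma> p = m" "\<And>q. q \<in> P - {p} \<Longrightarrow> \<sigma> q > m" for p \<sigma>
    proof (cases "p = p0")
      case True
      then show ?thesis using s qs by (auto simp: f_def Cons values_sorted_def)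
    next
      case False
      then have "p \<in> set qs" "\<sigma> p0 > m" using p p0 s by (auto simp: qs)
      then have "\<not> values_sorted ps \<sigma>" using s(1) by (fastforce simp: Cons values_sorted_def)
      then show ?thesis using False by (simp add: f_def)
    qed
    have rise0: "sum (f k ps) (extensions n m (insert (p, m) R)) =
        (if p = p0 then sum (f k qs) (extensions n m (insert (p0, m) R)) else 0)" if p: "p \<in> P" for p
    proof -
      have "f k ps \<sigma> = (if p = p0 then f k qs \<sigma> else 0)"
        if s: "\<sigma> \<in> extensions n m (insert (p, m) R)" for \<sigma>
        using extension_double_rise(1)[OF R, of p \<sigma> n] gt[OF _ s] s p open_position_le[of p k R]
        by (intro cl[OF p]) (auto simp: m_def P_def open_positions_Suc[OF R])
      then show ?thesis by (auto intro!: sum.cong sum.neutral)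
    qed
    have peak0: "sum (f k ps) (extensions n m (insert (p, m) (insert (m, v) R))) =
        (if p = p0 then sum (f k qs) (extensions n m (insert (p0, m) (insert (m, v) R))) else 0)"
      if p: "p \<in> P" for p v
    proof -
      have "f k ps \<sigma> = (if p = p0 then f k qs \<sigma> else 0)"
        if s: "\<sigma> \<in> extensions n m (insert (p, m) (insert (m, v) R))" for \<sigma>
        using extension_peak(1)[of \<sigma> n k p v R] gt[OF _ s] s p open_position_le[of p k R]
        by (intro cl[OF p]) (auto simp: m_def P_def open_positions_Suc[OF R])
      then show ?thesis by (auto intro!: sum.cong sum.neutral)
    qed
    have pp: "partial_perm m (insert (p0, m) R)"
      using partial_perm_Suc(4)[OF R] p0 by (auto simp: m_def P_def V_def)
    \<comment> \<open>After \<open>p0\<close> is closed, \<open>m\<close> may be inserted at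
      \<open>length qs + 1\<close> places, as many as the length of \<open>ps\<close>. It is never a
      pseudo-excedance, because the earlier position \<open>p0\<close> has the value
      \<open>m\<close>.\<close>
    have "sum (f k qs) (extensions n m (insert (p0, m) R)) =
       (\<Sum>r\<le>length qs. 1) * N (n - m) (Suc (length qs))"
    proof (rule insertion[OF pp])
      show "wt m \<sigma> = 1" if s: "\<sigma> \<in> extensions n m (insert (p0, m) R)" for \<sigma>
      proof -
        have "\<sigma> p0 = m" "\<sigma> m > m"
          using extension_double_rise[OF R, of p0 \<sigma> n] s p0 by (auto simp: m_def P_def)
        moreover have "p0 \<in> {1..n}" using open_position_le[of p0 k R] p0 kn by (auto simp: P_def)
        ultimately have "\<not> pseudo_excedance n m \<sigma>"
          using p0 by (auto simp: pseudo_excedance_def intro!: bexI[of _ p0])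
        then show ?thesis using \<open>\<sigma> m > m\<close> by (simp add: wt_def weight_def is_cycle_peak_def)
      qed
    qed (use qs R p0 in \<open>auto simp: m_def open_positions_Suc P_def\<close>)
    moreover have "(\<Sum>p\<in>P. sum (f k ps) (extensions n m (insert (p, m) R))) =
      sum (f k qs) (extensions n m (insert (p0, m) R))"
      using fin p0 by (simp add: rise0)
    ultimately have "(\<Sum>p\<in>P. sum (f k ps) (extensions n m (insert (p, m) R))) =
      of_nat (length ps) * N (n - m) (length ps)"
      by (simp add: Cons)
    moreover have "sum (f k qs) (extensions n m (insert (p0, m) (insert (m, v) R))) =
        (if v = a k R p0 then x else 1) * N (n - m) (length qs)" if v: "v \<in> V" for v
    proof (rule part)
      show "partial_perm m (insert (p0, m) (insert (m, v) R))"
        using partial_perm_Suc(5)[OF R] p0 v by (auto simp: m_def P_def V_def)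
      show "set qs = open_positions m (insert (p0, m) (insert (m, v) R))"
        using R qs p0 by (simp add: m_def open_positions_Suc P_def)
      show "wt m \<sigma> = (if v = a k R p0 then x else 1)"
        if s: "\<sigma> \<in> extensions n m (insert (p0, m) (insert (m, v) R))" for \<sigma>
      proof -
        have "\<sigma> m = v" "inv \<sigma> m = p0" using extension_peak[of \<sigma> n k p0 v R] s by (simp_all add: m_def)
        moreover have "v < m" using v open_value_le[of v k R] by (auto simp: m_def V_def)
        moreover have "A m \<sigma> \<longleftrightarrow> v = a k R p0"
          using A[OF kn R _ _ s[unfolded m_def]] p0 v by (simp add: m_def P_def V_def)
        ultimately show ?thesis
          using p0 by (simp add: wt_def weight_def is_cycle_peak_def pseudo_excedance_def)
      qed
    qed (fact qs)
    then have "(\<Sum>p\<in>P. \<Sum>v\<in>V. sum (f k ps) (extensions n m (insert (p, m) (insert (m, v) R)))) =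
       (\<Sum>v\<in>V. if v = a k R p0 then x else 1) * N (n - m) (length qs)"
      using fin p0 by (simp add: peak0 if_distrib[of "sum _"] sum_distrib_right sum.swap[of _ V P] cong: sum.cong)
    then have "(\<Sum>p\<in>P. \<Sum>v\<in>V. sum (f k ps) (extensions n m (insert (p, m) (insert (m, v) R)))) =
      (x + of_nat (length ps) - 1) * N (n - m) (length ps - 1)"
      using sum_marked[OF fin(2), of "a k R p0" x] a[OF R, of p0] p0 cV by (simp add: P_def V_def Cons)
    ultimately show ?thesis by (simp add: Cons)
  qed
  have nk: "n - k = Suc (n - m)" using kn by (simp add: m_def)
  have "sum (f k ps) (extensions n k R) = N (n - k) (length ps)"
    unfolding sum_extensions_Suc[OF R kn] m_def[symmetric] P_def[symmetric] V_def[symmetric] nk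
    using fin cV by (simp add: valley fix1 fall closing N_def algebra_simps)
  then show ?case by (simp add: f_def wt_def cong: if_cong)
qed

section \<open>Cycle maxima and antirecords\<close>

lemma path_end_exists:
  assumes R: "partial_perm k R" and v: "v \<in> open_values k R"
  shows "\<exists>p\<in>open_positions k R. (v, p) \<in> R\<^sup>*"
proof (rule ccontr)
  assume contra: "\<not> ?thesis"
  \<comment> \<open>If no open position were reachable from \<open>v\<close>, then \<open>R\<close>
    would map the finite set \<open>D\<close> injectively into itself, hence onto it. Then
    \<open>v\<close> would have a predecessor and would not be open.\<close>
  define D where "D = {j. (v, j) \<in> R\<^sup>*}"
  have RK: "R \<subseteq> {1..k} \<times> {1..k}" "single_valued (R\<inverse>)" using R by (auto simp: partial_perm_def)
  have D: "D \<subseteq> {1..k}"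
  proof
    fix j assume "j \<in> D"
    then have "(v, j) \<in> R\<^sup>*" by (simp add: D_def)
    then show "j \<in> {1..k}"
      by (cases rule: rtranclE) (use RK open_value_le[OF v] in auto)
  qed
  then have "\<forall>j\<in>D. \<exists>j'. (j, j') \<in> R" using contra by (auto simp: D_def open_positions_def)
  then obtain f where f: "\<And>j. j \<in> D \<Longrightarrow> (j, f j) \<in> R" by metis
  have "f ` D \<subseteq> D" using f by (auto simp: D_def intro: rtrancl_into_rtrancl)
  moreover have "inj_on f D"
    using f RK(2) unfolding inj_on_def single_valued_def by (metis converse_iff)
  ultimately have "f ` D = D" using D by (simp add: endo_inj_surj finite_subset)
  moreover have "v \<in> D" by (simp add: D_def)
  ultimately obtain j where "j \<in> D" "f j = v" by (metis imageE)
  then show False using f v by (auto simp: open_values_def)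
qed

text \<open>Successors are unique, so two indices reachable from \<open>v\<close> are comparable
  along \<open>R\<close>; an open position has no successor and therefore comes last.\<close>

lemma path_end_unique:
  assumes R: "partial_perm k R" and p: "p \<in> open_positions k R" and "(v, p) \<in> R\<^sup>*" "(v, j) \<in> R\<^sup>*"
  shows "(j, p) \<in> R\<^sup>*"
proof -
  have "(p, j) \<in> R\<^sup>* \<or> (j, p) \<in> R\<^sup>*"
    using R assms(3,4) by (intro single_valued_confluent) (auto simp: partial_perm_def)
  moreover have "j = p" if "(p, j) \<in> R\<^sup>*"
    using that p by (cases rule: converse_rtranclE) (auto simp: open_positions_def)
  ultimately show ?thesis by auto
qed

lemma path_ends:
  assumes R: "partial_perm k R" and "v \<in> open_values k R"
  shows "\<exists>!p. p \<in> open_positions k R \<and> (v, p) \<in> R\<^sup>*"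
proof (rule ex_ex1I)
  show "\<exists>p. p \<in> open_positions k R \<and> (v, p) \<in> R\<^sup>*" using path_end_exists[OF assms] by blast
  fix p q assume *: "p \<in> open_positions k R \<and> (v, p) \<in> R\<^sup>*" "q \<in> open_positions k R \<and> (v, q) \<in> R\<^sup>*"
  then have "(q, p) \<in> R\<^sup>*" using path_end_unique[OF R] by blast
  then show "p = q" by (cases rule: converse_rtranclE) (use * in \<open>auto simp: open_positions_def\<close>)
qed

text \<open>Reversing \<open>R\<close> exchanges open positions with open values, and ends of paths
  with starts.\<close>

lemma path_starts:
  assumes "partial_perm k R" and "p \<in> open_positions k R"
  shows "\<exists>!v. v \<in> open_values k R \<and> (v, p) \<in> R\<^sup>*"
  using path_ends[of k "R\<inverse>" p] assms
  by (simp add: partial_perm_converse open_positions_converse open_values_converse rtrancl_converse)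

text \<open>As a graph, \<open>R\<close> consists of cycles and of paths from open values to open
  positions. A path may be a single index that is open in both senses.\<close>

definition path_end :: "nat \<Rightarrow> (nat \<times> nat) set \<Rightarrow> nat \<Rightarrow> nat" where
  "path_end k R v = (THE p. p \<in> open_positions k R \<and> (v, p) \<in> R\<^sup>*)"

definition path_start :: "nat \<Rightarrow> (nat \<times> nat) set \<Rightarrow> nat \<Rightarrow> nat" where
  "path_start k R p = (THE v. v \<in> open_values k R \<and> (v, p) \<in> R\<^sup>*)"

lemma path_end:
  assumes "partial_perm k R" "v \<in> open_values k R"
  shows "path_end k R v \<in> open_positions k R"
    and "p \<in> open_positions k R \<Longrightarrow> p = path_end k R v \<longleftrightarrow> (v, p) \<in> R\<^sup>*"
  using path_ends[OF assms] theI'[OF path_ends[OF assms]] unfolding path_end_def by blast+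

lemma path_start:
  assumes "partial_perm k R" "p \<in> open_positions k R"
  shows "path_start k R p \<in> open_values k R"
    and "v \<in> open_values k R \<Longrightarrow> v = path_start k R p \<longleftrightarrow> (v, p) \<in> R\<^sup>*"
  using path_starts[OF assms] theI'[OF path_starts[OF assms]] unfolding path_start_def by blast+

section \<open>Cycle peaks that close a cycle\<close>

definition is_cycle_max :: "nat \<Rightarrow> (nat \<Rightarrow> nat) \<Rightarrow> bool" where
  "is_cycle_max i \<sigma> \<longleftrightarrow> orbit \<sigma> i \<subseteq> {..i}"

text \<open>The new index joins \<open>p\<close> to \<open>v\<close>. If the path from
  \<open>v\<close> ends in \<open>p\<close>, this closes a cycle within the first
  \<open>Suc k\<close> indices. Otherwise the path ends in a position that remains open, and its
  value is a larger element of the same cycle.\<close>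

lemma cycle_max_peak_iff:
  assumes R: "partial_perm k R" and p: "p \<in> open_positions k R" and v: "v \<in> open_values k R"
    and s: "\<sigma> \<in> extensions n (Suc k) (insert (p, Suc k) (insert (Suc k, v) R))"
  shows "is_cycle_max (Suc k) \<sigma> \<longleftrightarrow> (v, p) \<in> R\<^sup>*"
proof
  have sp: "\<sigma> p = Suc k" and sm: "\<sigma> (Suc k) = v" using extension_peak[OF s] by simp_all
  have sR: "\<sigma> i = j" if "(i, j) \<in> R" for i j using extensionsD(2)[OF s, of i j] that by auto
  have RK: "R \<subseteq> {1..k} \<times> {1..k}" using R by (simp add: partial_perm_def)
  {
    assume vp: "(v, p) \<in> R\<^sup>*"
    \<comment> \<open>The orbit runs along the path from \<open>v\<close>; at \<open>p\<close> it
      returns to \<open>Suc k\<close> and then to \<open>v\<close>.\<close>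
    have "j = Suc k \<or> (v, j) \<in> R\<^sup>*" if "j \<in> orbit \<sigma> (Suc k)" for j
      using that
    proof induction
      case base then show ?case by (simp add: sm)
    next
      case (step j)
      show ?case
      proof (cases "j = Suc k \<or> j = p")
        case True then show ?thesis using sp sm by auto
      next
        case False
        then have "(v, j) \<in> R\<^sup>*" "j \<noteq> p" using step by auto
        moreover have "(j, p) \<in> R\<^sup>*" using path_end_unique[OF R p vp] calculation by blast
        ultimately obtain i where "(j, i) \<in> R" by (metis converse_rtranclE)
        then show ?thesis using sR \<open>(v, j) \<in> R\<^sup>*\<close> by (metis rtrancl_into_rtrancl)
      qed
    qed
    moreover have "j \<le> k" if "(v, j) \<in> R\<^sup>*" for j
      using that by (cases rule: rtranclE) (use RK open_value_le[OF v] in auto)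
    ultimately show "is_cycle_max (Suc k) \<sigma>" by (force simp: is_cycle_max_def)
  next
    assume max: "is_cycle_max (Suc k) \<sigma>"
    obtain q where q: "q \<in> open_positions k R" "(v, q) \<in> R\<^sup>*" using path_end_exists[OF R v] by blast
    have "q \<in> orbit \<sigma> (Suc k)"
      using q(2)
    proof (induction rule: rtrancl_induct)
      case base show ?case using sm orbit.base[of \<sigma> "Suc k"] by simp
    next
      case (step i j) then show ?case using sR orbit.step by metis
    qed
    then have "\<sigma> q \<in> orbit \<sigma> (Suc k)" by (rule orbit.step)
    then have le: "\<sigma> q \<le> Suc k" using max by (auto simp: is_cycle_max_def)
    have "q = p"
    proof (rule ccontr)
      assume "q \<noteq> p"
      then have "q \<in> open_positions (Suc k) (insert (p, Suc k) (insert (Suc k, v) R))"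
        using q R open_position_le[OF p] by (simp add: open_positions_Suc)
      from extension_open_position[OF s this] le show False by simp
    qed
    then show "(v, p) \<in> R\<^sup>*" using q by simp
  }
qed

section \<open>Cycle peaks that are antirecords\<close>

lemma Min_open_values: "open_values k R \<noteq> {} \<Longrightarrow> Min (open_values k R) \<in> open_values k R"
  by (rule Min_in) simp_all

text \<open>A later position takes either a value above \<open>k\<close>, hence above
  \<open>v\<close>, or an open value other than \<open>v\<close>. Conversely, every other open value
  is taken at a later position, so a smaller one would violate the antirecord condition.\<close>

lemma antirecord_peak_iff:
  assumes kn: "k < n" and R: "partial_perm k R" and p: "p \<in> open_positions k R"
    and v: "v \<in> open_values k R"
    and s: "\<sigma> \<in> extensions n (Suc k) (insert (p, Suc k) (insert (Suc k, v) R))"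
  shows "is_antirecord n \<sigma> (Suc k) \<longleftrightarrow> v = Min (open_values k R)"
proof
  have sm: "\<sigma> (Suc k) = v" using extension_peak[OF s] by simp
  have perm: "\<sigma> permutes {1..n}" by (rule extensionsD(1)[OF s])
  have inj: "\<sigma> i = \<sigma> j \<Longrightarrow> i = j" for i j using permutes_inj[OF perm] by (auto dest: injD)
  {
    assume vm: "v = Min (open_values k R)"
    have "\<sigma> j > \<sigma> (Suc k)" if j: "j > Suc k" for j
    proof (cases "\<sigma> j \<le> k")
      case True
      have "(i, \<sigma> j) \<notin> R" for i
        using extensionsD(2)[OF s, of i "\<sigma> j"] inj[of i j] R j by (auto simp: partial_perm_def)
      then have "\<sigma> j \<in> open_values k R"
        using True permutes_ge_1[OF perm, of j] j by (auto simp: open_values_def)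
      then have "v \<le> \<sigma> j" using vm by simp
      moreover have "\<sigma> j \<noteq> \<sigma> (Suc k)" using inj[of j "Suc k"] j by auto
      ultimately show ?thesis using sm by simp
    next
      case False then show ?thesis using sm open_value_le[OF v] by simp
    qed
    then show "is_antirecord n \<sigma> (Suc k)" by (auto simp: is_antirecord_def)
  next
    assume ar: "is_antirecord n \<sigma> (Suc k)"
    define u where "u = Min (open_values k R)"
    have u: "u \<in> open_values k R" "u \<le> v"
      unfolding u_def using v by (auto intro!: Min_open_values)
    have "u = v"
    proof (rule ccontr)
      assume "u \<noteq> v"
      then have "u \<in> open_values (Suc k) (insert (p, Suc k) (insert (Suc k, v) R))"
        using u R open_value_le[OF v] by (simp add: open_values_Suc)
      from extension_open_value[OF s this] have gt: "inv \<sigma> u > Suc k" .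
      have "u \<in> {1..n}" using open_value_le[OF u(1)] kn by auto
      then have "inv \<sigma> u \<in> {1..n}" using permutes_in_image[OF permutes_inv[OF perm]] by blast
      then have "\<sigma> (inv \<sigma> u) > \<sigma> (Suc k)" using ar gt by (auto simp: is_antirecord_def)
      then show False using u(2) sm permutes_inverses(1)[OF perm] by simp
    qed
    then show "v = Min (open_values k R)" by (simp add: u_def)
  }
qed

text \<open>Pigeonhole: the \<open>i - 1\<close> earlier positions would have distinct values among
  the \<open>\<sigma> i - 1\<close> numbers below \<open>\<sigma> i\<close>. Thus exclusivity is
  automatic at cycle peaks.\<close>

lemma antirecord_peak_not_record:
  assumes perm: "\<sigma> permutes {1..n}" and i: "i \<in> {1..n}" "\<sigma> i < i"
  shows "\<not> is_record n \<sigma> i"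
proof
  assume "is_record n \<sigma> i"
  then have "\<sigma> ` {1..<i} \<subseteq> {1..<\<sigma> i}"
    using i permutes_ge_1[OF perm] by (force simp: is_record_def)
  then have "card (\<sigma> ` {1..<i}) \<le> card {1..<\<sigma> i}" by (intro card_mono) auto
  moreover have "card (\<sigma> ` {1..<i}) = card {1..<i}"
    using permutes_inj_on[OF perm] by (rule card_image)
  moreover have "\<sigma> i \<ge> 1" using permutes_ge_1[OF perm] i by auto
  ultimately show False using i by simp
qed

section \<open>The statistics as numbers of indices\<close>

lemma ear_altdef:
  assumes "\<sigma> permutes {1..n}"
  shows "ear n \<sigma> = card {i \<in> {1..n}. is_cycle_peak \<sigma> i \<and> is_antirecord n \<sigma> i}"
proof -
  have "{i \<in> {1..n}. is_exclusive_antirecord n \<sigma> i \<and> is_cycle_peak \<sigma> i} =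
    {i \<in> {1..n}. is_cycle_peak \<sigma> i \<and> is_antirecord n \<sigma> i}"
    using antirecord_peak_not_record[OF assms]
    by (auto simp: is_exclusive_antirecord_def is_cycle_peak_def)
  then show ?thesis by (simp add: ear_def)
qed

lemma pex_altdef: "pex n \<sigma> = card {i \<in> {1..n}. pseudo_excedance n i \<sigma>}"
  by (simp add: pex_def pseudo_excedance_def)

lemma pcyc_altdef:
  assumes perm: "\<sigma> permutes {1..n}"
  shows "pcyc n \<sigma> = card {i \<in> {1..n}. is_cycle_peak \<sigma> i \<and> is_cycle_max i \<sigma>}"
proof -
  have "permutation \<sigma>" using perm permutation_permutes by blast
  then have self: "i \<in> orbit \<sigma> i" for i by (rule permutation_self_in_orbit)
  have eq: "orbit \<sigma> j = orbit \<sigma> i" if "j \<in> orbit \<sigma> i" for i j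
    using that self by (metis orbit_cyclic_eq3 cyclic_on_orbit' \<open>permutation \<sigma>\<close>)
  have sub: "orbit \<sigma> i \<subseteq> {1..n}" if "i \<in> {1..n}" for i
    using permutes_orbit_subset[OF perm that] .
  \<comment> \<open>Each cycle is represented by its maximum, so \<open>orbit \<sigma>\<close> is a
    bijection from \<open>M\<close> to the set of cycles. Removing the fixed points \<open>F\<close>
    leaves the maxima of the nontrivial cycles, which are cycle peaks.\<close>
  define M where "M = {i \<in> {1..n}. is_cycle_max i \<sigma>}"
  have "inj_on (orbit \<sigma>) M"
  proof (rule inj_onI)
    fix i j assume "i \<in> M" "j \<in> M" "orbit \<sigma> i = orbit \<sigma> j"
    then show "i = j" using self[of i] self[of j] by (auto simp: M_def is_cycle_max_def intro: antisym)
  qed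
  moreover have "orbit \<sigma> ` M = orbit \<sigma> ` {1..n}"
  proof (intro equalityI subsetI)
    fix X assume "X \<in> orbit \<sigma> ` {1..n}"
    then obtain i where i: "i \<in> {1..n}" "X = orbit \<sigma> i" by blast
    have fin: "finite (orbit \<sigma> i)" "orbit \<sigma> i \<noteq> {}"
      using sub[OF i(1)] self[of i] by (auto intro: finite_subset)
    define m where "m = Max (orbit \<sigma> i)"
    have m: "m \<in> orbit \<sigma> i" using Max_in[OF fin] by (simp add: m_def)
    then have "orbit \<sigma> m = X" using eq i by simp
    moreover have "X \<subseteq> {..m}" using fin i by (auto simp: m_def)
    moreover have "m \<in> {1..n}" using m sub[OF i(1)] by blast
    ultimately show "X \<in> orbit \<sigma> ` M" by (auto simp: M_def is_cycle_max_def)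
  qed (auto simp: M_def)
  ultimately have cyc: "cyc n \<sigma> = card M" by (metis card_image cyc_def)
  define F where "F = {i \<in> {1..n}. \<sigma> i = i}"
  have FM: "F \<subseteq> M"
    by (auto simp: F_def M_def is_cycle_max_def orbit_eq_singleton_iff[THEN iffD2])
  have "M - F = {i \<in> {1..n}. is_cycle_peak \<sigma> i \<and> is_cycle_max i \<sigma>}"
  proof -
    have "is_cycle_peak \<sigma> i" if "is_cycle_max i \<sigma>" "\<sigma> i \<noteq> i" for i
    proof -
      have "inv \<sigma> i \<in> orbit \<sigma> i"
        using self orbit_inv_eq[OF \<open>permutation \<sigma>\<close>] orbit.base[of "inv \<sigma>" i] by metis
      moreover have "inv \<sigma> i \<noteq> i" using that(2) permutes_inverses(1)[OF perm, of i] by metis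
      moreover have "\<sigma> i \<in> orbit \<sigma> i" by (rule orbit.base)
      ultimately show ?thesis using that by (force simp: is_cycle_max_def is_cycle_peak_def)
    qed
    then show ?thesis by (auto simp: M_def F_def is_cycle_peak_def)
  qed
  moreover have "card (M - F) = card M - card F"
    using FM by (intro card_Diff_subset) (auto simp: F_def)
  ultimately show ?thesis by (simp add: pcyc_def cyc fixpts_def F_def)
qed

lemma open_positions_0 [simp]: "open_positions 0 R = {}"
  by (simp add: open_positions_def)

section \<open>The three joint distributions\<close>

lemma extensions_0: "extensions n 0 {} = {\<sigma>. \<sigma> permutes {1..n}}"
  by (auto simp: extensions_def trace_def)

lemma partial_perm_0: "partial_perm 0 {}"
  by (auto simp: partial_perm_def)

lemma A_poly_1_path_sum_product:
  "path_sum (\<lambda>_. 1) (\<lambda>h. w + of_nat h * 2) (\<lambda>h. (x + of_nat h - 1) * (y + of_nat h - 1)) n 0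
     = A_poly n 1 x y w"
  unfolding A_poly_def by (subst path_sum_eq_jfrac[where b = "\<lambda>k. 1 * (x + of_nat k - 1) * (y + of_nat k - 1)"]) simp_all

text \<open>The J-fraction depends only on the products of an up weight at \<open>h\<close> and a
  down weight at \<open>h + 1\<close>; here \<open>(y + h) * (x + h)\<close>, as in the unsplit
  version.\<close>

lemma A_poly_1_path_sum_split:
  "path_sum (\<lambda>h. y + of_nat h) (\<lambda>h. w + of_nat h * 2) (\<lambda>h. x + of_nat h - 1) n 0 = A_poly n 1 x y w"
  unfolding A_poly_def by (subst path_sum_eq_jfrac[where b = "\<lambda>k. 1 * (x + of_nat k - 1) * (y + of_nat k - 1)"]) (simp_all add: algebra_simps)

lemma A_poly_1_ear_pcyc:
  "A_poly n 1 x y w = (\<Sum>\<sigma> | \<sigma> permutes {1..n}. x ^ ear n \<sigma> * y ^ pcyc n \<sigma> * w ^ fixpts n \<sigma>)"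
proof -
  have "A_poly n 1 x y w = (\<Sum>\<sigma>\<in>extensions n 0 {}. \<Prod>i\<in>{0<..n}.
      weight w x y (\<lambda>i \<sigma>. is_antirecord n \<sigma> i) (\<lambda>i \<sigma>. is_cycle_peak \<sigma> i \<and> is_cycle_max i \<sigma>) i \<sigma>)"
    \<comment> \<open>For a given value, the marked position is the end of the path that starts at
      this value.\<close>
    by (subst sum_weight_unordered[where a = "\<lambda>k R. Min (open_values k R)" and b = path_end])
       (auto simp: antirecord_peak_iff cycle_max_peak_iff path_end partial_perm_0 A_poly_1_path_sum_product
         Min_open_values)
  also have "\<dots> = (\<Sum>\<sigma> | \<sigma> permutes {1..n}. x ^ ear n \<sigma> * y ^ pcyc n \<sigma> * w ^ fixpts n \<sigma>)"
    unfolding extensions_0 prod_weight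
    by (intro sum.cong refl) (simp add: ear_altdef pcyc_altdef mult_ac)
  finally show ?thesis .
qed

lemma A_poly_1_ear_pex:
  "A_poly n 1 x y w = (\<Sum>\<sigma> | \<sigma> permutes {1..n}. x ^ ear n \<sigma> * y ^ pex n \<sigma> * w ^ fixpts n \<sigma>)"
proof -
  have ne: "open_values k R \<noteq> {}" if "partial_perm k R" "p \<in> open_positions k R" for k R p
    using path_start(1)[OF that] by auto
  \<comment> \<open>At the start there are no open positions, so the order is empty and the
    condition holds for every permutation.\<close>
  have "A_poly n 1 x y w = (\<Sum>\<sigma>\<in>extensions n 0 {}. if values_sorted [] \<sigma> then \<Prod>i\<in>{0<..n}.
      weight w x y (\<lambda>i \<sigma>. is_antirecord n \<sigma> i) (pseudo_excedance n) i \<sigma> else 0)"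
    by (subst sum_weight_ordered[where a = "\<lambda>k R p. Min (open_values k R)"])
       (auto simp: antirecord_peak_iff partial_perm_0 A_poly_1_path_sum_split
         intro!: Min_open_values dest: ne)
  also have "\<dots> = (\<Sum>\<sigma> | \<sigma> permutes {1..n}. x ^ ear n \<sigma> * y ^ pex n \<sigma> * w ^ fixpts n \<sigma>)"
    unfolding extensions_0 prod_weight
    by (intro sum.cong refl) (simp add: ear_altdef pex_altdef values_sorted_def mult_ac)
  finally show ?thesis .
qed

lemma A_poly_1_pcyc_pex:
  "A_poly n 1 x y w = (\<Sum>\<sigma> | \<sigma> permutes {1..n}. x ^ pcyc n \<sigma> * y ^ pex n \<sigma> * w ^ fixpts n \<sigma>)"
proof -
  have "A_poly n 1 x y w = (\<Sum>\<sigma>\<in>extensions n 0 {}. if values_sorted [] \<sigma> then \<Prod>i\<in>{0<..n}.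
      weight w x y is_cycle_max (pseudo_excedance n) i \<sigma> else 0)"
    \<comment> \<open>Here the order dictates the position to be closed, so closing a cycle is read
      as a condition on the value: it must start the path ending at that position.\<close>
    by (subst sum_weight_ordered[where a = path_start])
       (auto simp: cycle_max_peak_iff path_start partial_perm_0 A_poly_1_path_sum_split)
  also have "\<dots> = (\<Sum>\<sigma> | \<sigma> permutes {1..n}. x ^ pcyc n \<sigma> * y ^ pex n \<sigma> * w ^ fixpts n \<sigma>)"
    unfolding extensions_0 prod_weight
    by (intro sum.cong refl) (simp add: pcyc_altdef pex_altdef values_sorted_def mult_ac)
  finally show ?thesis .
qed

theorem theorem1p7:
  fixes y lam :: "'a::comm_ring_1" and n :: nat
  shows "C_poly n y lam = (\<Sum>\<sigma> | \<sigma> permutes {1..n}. y ^ (pex n \<sigma>) * lam ^ (ear n \<sigma> + fixpts n \<sigma>))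
       \<and> C_poly n y lam = (\<Sum>\<sigma> | \<sigma> permutes {1..n}. y ^ (ear n \<sigma>) * lam ^ (pex n \<sigma> + fixpts n \<sigma>))
       \<and> C_poly n y lam = (\<Sum>\<sigma> | \<sigma> permutes {1..n}. y ^ (pcyc n \<sigma>) * lam ^ (ear n \<sigma> + fixpts n \<sigma>))
       \<and> C_poly n y lam = (\<Sum>\<sigma> | \<sigma> permutes {1..n}. y ^ (ear n \<sigma>) * lam ^ (cyc n \<sigma>))
       \<and> C_poly n y lam = (\<Sum>\<sigma> | \<sigma> permutes {1..n}. y ^ (pcyc n \<sigma>) * lam ^ (pex n \<sigma> + fixpts n \<sigma>))
       \<and> C_poly n y lam = (\<Sum>\<sigma> | \<sigma> permutes {1..n}. y ^ (pex n \<sigma>) * lam ^ (cyc n \<sigma>))"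
proof -
  have cyc: "cyc n \<sigma> = pcyc n \<sigma> + fixpts n \<sigma>" for \<sigma>
    using fixpts_le_cyc[of n \<sigma>] by (simp add: pcyc_def)
  \<comment> \<open>The continued fraction is symmetric in \<open>y\<close> and \<open>lam\<close>.
    Each of the three joint distributions is therefore used with both assignments of these
    variables, which gives all six sums.\<close>
  note C = C_poly_def[of n y lam] C_poly_altdef[of n y lam]
  show ?thesis
    using C A_poly_1_ear_pex[of n lam y lam] A_poly_1_ear_pex[of n y lam lam]
      A_poly_1_ear_pcyc[of n lam y lam] A_poly_1_ear_pcyc[of n y lam lam]
      A_poly_1_pcyc_pex[of n lam y lam] A_poly_1_pcyc_pex[of n y lam lam]
    by (simp add: cyc power_add mult_ac)
qed

end
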